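(* Let $\psi$, $\phi$, $c_\psi$, $\rho$, $\Omega$ and $\mathscr D$ be as in the context and fix $3<p<\infty$. There exist $\delta_0>0$ and $C<\infty$, depending on $\Omega$, $p$ and $\psi$, such that if $k$ is a continuous symmetric two-tensor on $\Omega$ and $v\in W^{1,p}(\Omega)$ satisfy $$\|k\|_{C^0(\Omega)}+\|v\|_{W^{1,p}(\Omega)}\le\delta_0,$$ then $$\mathscr D(\delta+k,\rho+v)=\mathscr D(\delta,\rho)+\mathcal L_D(k,v)+\mathcal R(k,v),$$ where $$\begin{aligned}\mathcal L_D(k,v)=&\int_\Omega\phi'(\rho)|\nabla\rho|^3v\,dy+3\int_\Omega\phi(\rho)|\nabla\rho|\langle\nabla\rho,\nabla v\rangle\,dy\\&+\int_\Omega\phi(\rho)\left[\tfrac12(\operatorname{tr}k)|\nabla\rho|^3-\tfrac32|\nabla\rho|\,k(\nabla\rho,\nabla\rho)\right]dy,\end{aligned}$$ and $$|\mathcal R(k,v)|\le C\left(\|k\|_{C^0(\Omega)}+\|v\|_{W^{1,p}(\Omega)}\right)^2 .$$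
   Context: $\delta$ is the Euclidean metric on $\mathbb R^3$; $\nabla$, $|\cdot|$, $\langle\cdot,\cdot\rangle$, $\operatorname{tr}$, $dy$ are Euclidean. Fix $\psi\in C_c^\infty((0,1))$ with $\psi\ge0$, $\int_0^1\psi=1$, and set $$c_\psi=2\pi\int_0^1\frac{\psi(s)}{1+s}\,ds,\qquad \phi(t)=\frac1{t^3}\left[\tfrac12\psi\left(\tfrac1{2t}-1\right)-\psi\left(\tfrac1t-1\right)\right]\quad(t>0),$$ where $\psi$ is extended by zero; the support of $\phi$ is a compact subset of $(1/4,1)$. Let $\rho(y)=|y|^{-1}$. $\Omega=B_\Lambda\setminus B_\lambda$, $0<\lambda<\Lambda<\infty$, is a fixed annulus centered at the origin such that the support of $\phi(\rho)$ is compactly contained in $\Omega$. For a continuous Riemannian metric $\gamma$ on $\Omega$ close to $\delta$ and $f\in W^{1,p}(\Omega)$ close to $\rho$, $$\mathscr D(\gamma,f)=c_\psi+\int_\Omega\phi(f)\,|\nabla_\gamma f|_\gamma^3\,dv_\gamma .$$ The $C^0(\Omega)$ norm is the supremum norm. *)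

theory Defs
  imports "HOL-Analysis.Analysis"
begin

section \<open>Smooth functions and test functions\<close>

primrec Ck :: "nat \<Rightarrow> ('a::euclidean_space \<Rightarrow> real) \<Rightarrow> bool" where
  "Ck 0 f \<longleftrightarrow> continuous_on UNIV f"
| "Ck (Suc n) f \<longleftrightarrow> (\<forall>x. f differentiable (at x)) \<and>
     (\<forall>i\<in>Basis. Ck n (\<lambda>x. frechet_derivative f (at x) i))"

definition smooth :: "('a::euclidean_space \<Rightarrow> real) \<Rightarrow> bool" where
  "smooth f \<longleftrightarrow> (\<forall>n. Ck n f)"

definition compactly_supported_in :: "'a::euclidean_space set \<Rightarrow> ('a \<Rightarrow> real) \<Rightarrow> bool" where
  "compactly_supported_in U f \<longleftrightarrow>
     compact (closure {x. f x \<noteq> 0}) \<and> closure {x. f x \<noteq> 0} \<subseteq> U"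

text \<open>Elements of \<open>C\<^sub>c\<^sup>\<infinity>(U)\<close>, for open \<open>U\<close>, are represented by their extensions by zero.\<close>

definition test_function :: "'a::euclidean_space set \<Rightarrow> ('a \<Rightarrow> real) \<Rightarrow> bool" where
  "test_function U \<eta> \<longleftrightarrow> smooth \<eta> \<and> compactly_supported_in U \<eta>"

section \<open>Sobolev functions\<close>

definition in_Lp :: "'a::euclidean_space set \<Rightarrow> real \<Rightarrow> ('a \<Rightarrow> 'b::euclidean_space) \<Rightarrow> bool" where
  "in_Lp U p f \<longleftrightarrow> f \<in> borel_measurable (lebesgue_on U) \<and>
     integrable (lebesgue_on U) (\<lambda>x. norm (f x) powr p)"

definition locally_integrable_on :: "'a::euclidean_space set \<Rightarrow> ('a \<Rightarrow> 'b::euclidean_space) \<Rightarrow> bool" where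
  "locally_integrable_on U f \<longleftrightarrow> (\<forall>K. compact K \<and> K \<subseteq> U \<longrightarrow> integrable (lebesgue_on K) f)"

definition is_weak_gradient ::
    "'a::euclidean_space set \<Rightarrow> ('a \<Rightarrow> real) \<Rightarrow> ('a \<Rightarrow> 'a) \<Rightarrow> bool" where
  "is_weak_gradient U f g \<longleftrightarrow>
     locally_integrable_on U f \<and> locally_integrable_on U g \<and>
     (\<forall>\<eta>. test_function U \<eta> \<longrightarrow> (\<forall>i\<in>Basis.
        (LINT x|lebesgue_on U. f x * frechet_derivative \<eta> (at x) i) =
        - (LINT x|lebesgue_on U. (g x \<bullet> i) * \<eta> x)))"

text \<open>On an open set a weak gradient is unique up to null sets; one representative is chosen.
  It is only ever used under integrals.\<close>

definition weak_grad :: "'a::euclidean_space set \<Rightarrow> ('a \<Rightarrow> real) \<Rightarrow> 'a \<Rightarrow> 'a" where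
  "weak_grad U f = (SOME g. is_weak_gradient U f g)"

definition in_W1p :: "'a::euclidean_space set \<Rightarrow> real \<Rightarrow> ('a \<Rightarrow> real) \<Rightarrow> bool" where
  "in_W1p U p f \<longleftrightarrow> in_Lp U p f \<and> (\<exists>g. is_weak_gradient U f g \<and> in_Lp U p g)"

definition W1p_norm :: "'a::euclidean_space set \<Rightarrow> real \<Rightarrow> ('a \<Rightarrow> real) \<Rightarrow> real" where
  "W1p_norm U p f =
     ((LINT x|lebesgue_on U. \<bar>f x\<bar> powr p) +
      (LINT x|lebesgue_on U. norm (weak_grad U f x) powr p)) powr (1 / p)"

section \<open>Continuous symmetric two-tensors and metrics\<close>

text \<open>A two-tensor on \<open>U\<close> is given by its matrix in the standard basis, so that
  \<open>k(X,Y) = X \<bullet> (k *v Y)\<close>; the norm of the type \<^typ>\<open>real^3^3\<close> is the Euclidean tensor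
  (Frobenius) norm.\<close>

type_synonym tensor2 = "real^3 \<Rightarrow> real^3^3"

text \<open>Boundedness expresses that the \<open>C\<^sup>0\<close> norm is finite, so that the real supremum is
  the actual one.\<close>

definition bounded_continuous_symmetric :: "(real^3) set \<Rightarrow> tensor2 \<Rightarrow> bool" where
  "bounded_continuous_symmetric U k \<longleftrightarrow>
     continuous_on U k \<and> bounded (k ` U) \<and> (\<forall>y\<in>U. transpose (k y) = k y)"

definition C0_norm :: "(real^3) set \<Rightarrow> tensor2 \<Rightarrow> real" where
  "C0_norm U k = (SUP y\<in>U. norm (k y))"

definition flat_metric :: tensor2 where
  "flat_metric = (\<lambda>y. mat 1)"

definition metric_grad :: "tensor2 \<Rightarrow> (real^3) set \<Rightarrow> (real^3 \<Rightarrow> real) \<Rightarrow> real^3 \<Rightarrow> real^3" where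
  "metric_grad \<gamma> U f y = matrix_inv (\<gamma> y) *v weak_grad U f y"

definition metric_norm :: "tensor2 \<Rightarrow> real^3 \<Rightarrow> real^3 \<Rightarrow> real" where
  "metric_norm \<gamma> y X = sqrt (X \<bullet> (\<gamma> y *v X))"

definition volume_density :: "tensor2 \<Rightarrow> real^3 \<Rightarrow> real" where
  "volume_density \<gamma> y = sqrt (det (\<gamma> y))"

section \<open>The functional and its linearization\<close>

definition c_psi :: "(real \<Rightarrow> real) \<Rightarrow> real" where
  "c_psi \<psi> = 2 * pi * integral {0..1} (\<lambda>s. \<psi> s / (1 + s))"

text \<open>If \<open>\<psi>\<close> vanishes outside \<open>(0,1)\<close>, this formula is automatically zero for \<open>t \<le> 0\<close>.\<close>

definition phi :: "(real \<Rightarrow> real) \<Rightarrow> real \<Rightarrow> real" where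
  "phi \<psi> t = 1 / t ^ 3 * (1 / 2 * \<psi> (1 / (2 * t) - 1) - \<psi> (1 / t - 1))"

definition rho :: "real^3 \<Rightarrow> real" where
  "rho y = inverse (norm y)"

definition annulus :: "real \<Rightarrow> real \<Rightarrow> (real^3) set" where
  "annulus l L = ball 0 L - cball 0 l"

definition D_functional ::
    "(real \<Rightarrow> real) \<Rightarrow> (real^3) set \<Rightarrow> tensor2 \<Rightarrow> (real^3 \<Rightarrow> real) \<Rightarrow> real" where
  "D_functional \<psi> U \<gamma> f = c_psi \<psi> +
     (LINT y|lebesgue_on U.
        phi \<psi> (f y) * metric_norm \<gamma> y (metric_grad \<gamma> U f y) ^ 3 * volume_density \<gamma> y)"

definition L_D ::
    "(real \<Rightarrow> real) \<Rightarrow> (real^3) set \<Rightarrow> tensor2 \<Rightarrow> (real^3 \<Rightarrow> real) \<Rightarrow> real" where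
  "L_D \<psi> U k v =
     (LINT y|lebesgue_on U. deriv (phi \<psi>) (rho y) * norm (weak_grad U rho y) ^ 3 * v y)
     + 3 * (LINT y|lebesgue_on U. phi \<psi> (rho y) * norm (weak_grad U rho y) *
              (weak_grad U rho y \<bullet> weak_grad U v y))
     + (LINT y|lebesgue_on U. phi \<psi> (rho y) *
          (1 / 2 * trace (k y) * norm (weak_grad U rho y) ^ 3
           - 3 / 2 * norm (weak_grad U rho y) *
             (weak_grad U rho y \<bullet> (k y *v weak_grad U rho y))))"

end

theory Submission
  imports Defs
begin

text \<open>Since \<open>\<psi>\<close> has compact support in \<open>(0,1)\<close>, \<open>\<phi>\<close> extends by zero to a compactly
  supported \<open>C\<^sup>2\<close> function on the whole line, so its second-order Taylor estimate holds globally
  and no Sobolev embedding is needed. The integrand is then expanded pointwise: with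
  \<open>a = \<nabla>\<rho>\<close>, which is bounded, and \<open>b = \<nabla>v\<close>, the remainder is at most a constant times
  \<open>\<kappa>\<^sup>2 + v\<^sup>2 + |b|\<^sup>2 + |b|\<^sup>3\<close>, where \<open>\<kappa>\<close> is the \<open>C\<^sup>0\<close> norm of \<open>k\<close>. Because \<open>p > 3\<close> and
  \<open>\<Omega>\<close> has finite measure, integrating this gives a quadratic bound. That weak gradients may be
  added and compared pointwise at all rests on their almost everywhere uniqueness; the test
  functions needed for it are built from the antiderivative of \<open>\<psi>\<close>, a smooth step function.\<close>

section \<open>Pointwise expansion of the energy density\<close>

text \<open>Smallness of \<open>v\<close> in the Sobolev norm gives no pointwise smallness of its
  gradient \<open>b\<close>, so the estimates must hold for all vectors \<open>b\<close>, with
  explicit polynomial growth. This fixes the order of expansion: the metric is expanded first, at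
  the full gradient \<open>a + b\<close>, where the density is homogeneous of degree three and the
  error is \<open>\<kappa>\<^sup>2\<close> times a cube; only then is \<open>a + b\<close> compared
  with \<open>a\<close>. The term |b|^3 is what requires cubic integrability, and it is still of
  second order because the Sobolev norm is at most 1. The tensor, in contrast, is uniformly small:
  below 1/24 the matrix \<open>mat 1 + k\<close> is invertible, its determinant is nonnegative, and
  the quadratic errors are dominated by linear ones. The uniqueness argument is forced by
  \<open>weak_grad\<close>, which picks a representative separately for \<open>rho\<close>, for
  \<open>v\<close> and for their sum.\<close>

lemma norm_matrix_vector_mult_le:
  fixes A :: "real^'n^'m"
  shows "norm (A *v x) \<le> norm A * norm x"
proof -
  have "norm (A *v x) \<le> L2_set (\<lambda>i. norm (A $ i) * norm x) UNIV"
    unfolding norm_vec_def[of "A *v x"]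
    by (intro L2_set_mono) (auto simp: matrix_vector_mul_component Cauchy_Schwarz_ineq2)
  also have "\<dots> = norm A * norm x"
    by (simp add: norm_vec_def[of A] L2_set_left_distrib)
  finally show ?thesis .
qed

lemma abs_entry_le_norm:
  fixes A :: "real^'n^'m"
  shows "\<bar>A $ i $ j\<bar> \<le> norm A"
  by (meson Finite_Cartesian_Product.norm_nth_le component_le_norm_cart order_trans)

text \<open>The terms after the trace are the three principal 2x2 minors and the determinant of
  \<open>A\<close>: six quadratic and six cubic monomials in the entries. Each is at most
  \<open>(norm A)\<^sup>2\<close> because \<open>norm A \<le> 1\<close>, hence the 12.\<close>

lemma det_mat_1_plus_3:
  fixes A :: "real^3^3"
  assumes "norm A \<le> 1"
  shows "\<bar>det (mat 1 + A) - 1 - trace A\<bar> \<le> 12 * (norm A)\<^sup>2"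
proof -
  define \<kappa> where "\<kappa> = norm A"
  have k0: "0 \<le> \<kappa>" "\<kappa> \<le> 1" using assms by (auto simp: \<kappa>_def)
  have e: "\<bar>A $ i $ j\<bar> \<le> \<kappa>" for i j unfolding \<kappa>_def by (rule abs_entry_le_norm)
  have p2: "\<bar>A $ i $ j * A $ m $ n\<bar> \<le> \<kappa>\<^sup>2" for i j m n
    unfolding abs_mult power2_eq_square by (intro mult_mono e k0 abs_ge_zero)
  have p3: "\<bar>A $ i $ j * A $ m $ n * A $ q $ r\<bar> \<le> \<kappa>\<^sup>2" for i j m n q r
  proof -
    have "\<bar>A $ i $ j * A $ m $ n * A $ q $ r\<bar> \<le> \<kappa>\<^sup>2 * \<kappa>"
      unfolding abs_mult[of "A $ i $ j * A $ m $ n"] by (intro mult_mono e p2 k0 abs_ge_zero) simp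
    also have "\<dots> \<le> \<kappa>\<^sup>2" using k0 by (simp add: mult_left_le)
    finally show ?thesis .
  qed
  let ?a = "\<lambda>i j. A $ i $ j"
  have eq: "det (mat 1 + A) - 1 - trace A =
     (?a 1 1 * ?a 2 2 - ?a 1 2 * ?a 2 1) + (?a 1 1 * ?a 3 3 - ?a 1 3 * ?a 3 1)
     + (?a 2 2 * ?a 3 3 - ?a 2 3 * ?a 3 2)
     + ?a 1 1 * ?a 2 2 * ?a 3 3 + ?a 1 2 * ?a 2 3 * ?a 3 1 + ?a 1 3 * ?a 2 1 * ?a 3 2
     - ?a 1 1 * ?a 2 3 * ?a 3 2 - ?a 1 2 * ?a 2 1 * ?a 3 3 - ?a 1 3 * ?a 2 2 * ?a 3 1"
    by (simp add: det_3 trace_def sum_3 mat_def algebra_simps)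
  have add: "\<bar>x + y\<bar> \<le> s + t" and diff: "\<bar>x - y\<bar> \<le> s + t"
    if "\<bar>x\<bar> \<le> s" "\<bar>y\<bar> \<le> t" for x y s t :: real using that by linarith+
  have "\<bar>det (mat 1 + A) - 1 - trace A\<bar> \<le> 12 * \<kappa>\<^sup>2"
    \<comment> \<open>\<open>order_trans\<close> leaves the upper bound schematic; splitting off one
      monomial at a time instantiates it to a sum of twelve copies of
      \<open>\<kappa>\<^sup>2\<close>.\<close>
    unfolding eq by (rule order_trans, (rule add diff p2 p3)+) simp
  then show ?thesis by (simp add: \<kappa>_def)
qed

lemma abs_trace_le_3:
  fixes A :: "real^3^3"
  shows "\<bar>trace A\<bar> \<le> 3 * norm A"
  using abs_entry_le_norm[of A 1 1] abs_entry_le_norm[of A 2 2] abs_entry_le_norm[of A 3 3]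
  by (simp add: trace_def sum_3)

text \<open>A nonzero kernel vector would satisfy x = - A x, although \<open>A\<close> strictly
  shrinks nonzero vectors.\<close>

lemma invertible_mat_1_plus:
  fixes A :: "real^'n^'n"
  assumes "norm A < 1"
  shows "invertible (mat 1 + A)"
proof -
  have "x = 0" if "(mat 1 + A) *v x = 0" for x
  proof (rule ccontr)
    assume "x \<noteq> 0"
    have "x = - (A *v x)" using that by (simp add: matrix_vector_mult_add_rdistrib eq_neg_iff_add_eq_0)
    then have "norm x \<le> norm A * norm x"
      using norm_matrix_vector_mult_le[of A x] by (metis norm_minus_cancel)
    with \<open>x \<noteq> 0\<close> assms show False by simp
  qed
  then show ?thesis by (metis invertible_left_inverse matrix_left_invertible_ker)
qed

lemma matrix_inv_vector_mult:
  fixes A :: "real^'n^'n"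
  assumes "invertible A"
  shows "A *v (matrix_inv A *v w) = w"
  using someI_ex[OF assms[unfolded invertible_def]]
  by (simp add: matrix_vector_mul_assoc matrix_inv_def)

text \<open>One step of the Neumann series: \<open>u = w - A u = w - A w + A (A u)\<close>.\<close>

lemma quadratic_form_inverse_expansion:
  fixes A :: "real^'n^'n"
  assumes "norm A \<le> 1/2"
  shows "\<bar>w \<bullet> (matrix_inv (mat 1 + A) *v w) - (norm w)\<^sup>2 + w \<bullet> (A *v w)\<bar>
    \<le> 2 * (norm A)\<^sup>2 * (norm w)\<^sup>2"
proof -
  define u where "u = matrix_inv (mat 1 + A) *v w"
  have inv: "invertible (mat 1 + A)" using assms by (intro invertible_mat_1_plus) simp
  have "(mat 1 + A) *v u = w"
    unfolding u_def by (rule matrix_inv_vector_mult[OF inv])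
  then have u: "u = w - A *v u" by (simp add: matrix_vector_mult_add_rdistrib eq_diff_eq)
  \<comment> \<open>As \<open>norm A \<le> 1/2\<close>, the last term is absorbed on the left; this
    yields the factor 2 of the final bound.\<close>
  have "norm u \<le> norm w + norm A * norm u"
    using norm_triangle_ineq4[of w "A *v u"] norm_matrix_vector_mult_le[of A u]
    by (metis add_left_mono order_trans u)
  moreover have "norm A * norm u \<le> 1/2 * norm u" using assms by (intro mult_right_mono) auto
  ultimately have nu: "norm u \<le> 2 * norm w" by simp
  have "w \<bullet> u - (norm w)\<^sup>2 + w \<bullet> (A *v w) = w \<bullet> (A *v (A *v u))"
  proof -
    have "A *v u = A *v w - A *v (A *v u)"
      by (subst u) (rule matrix_vector_mult_diff_distrib)
    then have "w \<bullet> (A *v u) = w \<bullet> (A *v w) - w \<bullet> (A *v (A *v u))"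
      by (metis inner_diff_right)
    moreover have "w \<bullet> u = (norm w)\<^sup>2 - w \<bullet> (A *v u)"
      by (subst u) (simp add: inner_diff_right power2_norm_eq_inner)
    ultimately show ?thesis by simp
  qed
  also have "\<bar>\<dots>\<bar> \<le> norm w * (norm A * (norm A * norm u))"
    by (meson Cauchy_Schwarz_ineq2 mult_left_mono norm_ge_zero norm_matrix_vector_mult_le order_trans)
  also have "\<dots> \<le> norm w * (norm A * (norm A * (2 * norm w)))"
    by (intro mult_left_mono nu) auto
  finally show ?thesis by (simp add: u_def power2_eq_square mult_ac)
qed

section \<open>Second-order scalar and vector expansions with explicit remainders\<close>

lemma abs_sqrt_diff_1_le:
  fixes z :: real
  assumes "0 \<le> z" shows "\<bar>sqrt z - 1\<bar> \<le> \<bar>z - 1\<bar>"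
proof -
  have "z - 1 = (sqrt z - 1) * (sqrt z + 1)" using assms by (simp add: algebra_simps)
  then have "\<bar>z - 1\<bar> = \<bar>sqrt z - 1\<bar> * (sqrt z + 1)" using assms by (simp add: abs_mult)
  moreover have "\<bar>sqrt z - 1\<bar> * 1 \<le> \<bar>sqrt z - 1\<bar> * (sqrt z + 1)"
    using assms by (intro mult_left_mono) auto
  ultimately show ?thesis by simp
qed

text \<open>The error is exactly \<open>- (sqrt z - 1)\<^sup>2 / 2\<close>, so the preceding
  Lipschitz bound gives the estimate even at z = 0, where the root is not differentiable.\<close>

lemma sqrt_expansion_at_1:
  fixes z :: real
  assumes "0 \<le> z" shows "\<bar>sqrt z - 1 - (z - 1) / 2\<bar> \<le> (z - 1)\<^sup>2"
proof -
  have "z = sqrt z * sqrt z" using assms by simp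
  then have "sqrt z - 1 - (z - 1) / 2 = - (sqrt z - 1)\<^sup>2 / 2"
    unfolding power2_eq_square by algebra
  then have "\<bar>sqrt z - 1 - (z - 1) / 2\<bar> = \<bar>sqrt z - 1\<bar>\<^sup>2 / 2" by simp
  also have "\<dots> \<le> \<bar>z - 1\<bar>\<^sup>2 / 2"
    using abs_sqrt_diff_1_le[OF assms] by (intro divide_right_mono power_mono) auto
  also have "\<dots> \<le> (z - 1)\<^sup>2" by simp
  finally show ?thesis .
qed

text \<open>In terms of s = sqrt z the error is exactly \<open>(s - 1)\<^sup>2 * (s + 1/2)\<close>;
  the crude bound s \<le> 2 makes the second factor less than 3.\<close>

lemma sqrt_cubed_expansion_at_1:
  fixes z :: real
  assumes "0 \<le> z" "z \<le> 2" shows "\<bar>sqrt z ^ 3 - 1 - 3/2 * (z - 1)\<bar> \<le> 3 * (z - 1)\<^sup>2"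
proof -
  define s where "s = sqrt z"
  have z: "z = s\<^sup>2" and s: "0 \<le> s" using assms by (auto simp: s_def)
  have "s \<le> 2" using assms by (auto simp: s_def intro!: real_le_lsqrt)
  have eq: "s ^ 3 - 1 - 3/2 * (s\<^sup>2 - 1) = (s - 1)\<^sup>2 * (s + 1/2)"
    by (simp add: power2_eq_square power3_eq_cube field_simps)
  have "\<bar>s ^ 3 - 1 - 3/2 * (s\<^sup>2 - 1)\<bar> \<le> (z - 1)\<^sup>2 * 3" unfolding eq
  proof -
    have "\<bar>s - 1\<bar>\<^sup>2 \<le> \<bar>z - 1\<bar>\<^sup>2"
      using abs_sqrt_diff_1_le[OF assms(1)] unfolding s_def by (intro power_mono) auto
    then show "\<bar>(s - 1)\<^sup>2 * (s + 1/2)\<bar> \<le> (z - 1)\<^sup>2 * 3"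
      using s \<open>s \<le> 2\<close> unfolding abs_mult by (intro mult_mono) auto
  qed
  then show ?thesis by (simp only: s_def[symmetric] z[symmetric] mult.commute[of _ 3])
qed

text \<open>Polarization expresses the inner product by the lengths s, r and \<open>norm b\<close>,
  which makes the error an explicit nonnegative polynomial. The estimate thus covers all
  \<open>b\<close>, also where \<open>a\<close> or \<open>a + b\<close> vanishes; the price is the
  extra growth that produces the cubic term.\<close>

lemma norm_add_cubed_expansion:
  fixes a b :: "'a::real_inner"
  shows "\<bar>norm (a + b) ^ 3 - norm a ^ 3 - 3 * norm a * (a \<bullet> b)\<bar>
    \<le> (norm b)\<^sup>2 * (3 * norm a + norm b)"
proof -
  define s r where "s = norm (a + b)" and "r = norm a"
  have sr: "\<bar>s - r\<bar> \<le> norm b" "s \<le> r + norm b" "0 \<le> s" "0 \<le> r"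
    using norm_triangle_ineq3[of "a + b" a] norm_triangle_ineq[of a b] by (auto simp: s_def r_def)
  have ab: "a \<bullet> b = (s\<^sup>2 - r\<^sup>2 - (norm b)\<^sup>2) / 2"
    by (simp add: s_def r_def power2_norm_eq_inner inner_add inner_commute)
  have eq: "s ^ 3 - r ^ 3 - 3 * r * (a \<bullet> b) = (s - r)\<^sup>2 * (s + r/2) + 3/2 * r * (norm b)\<^sup>2"
    unfolding ab by (simp add: power2_eq_square power3_eq_cube field_simps)
  have "(s - r)\<^sup>2 * (s + r/2) + 3/2 * r * (norm b)\<^sup>2
      \<le> (norm b)\<^sup>2 * (r + norm b + r/2) + 3/2 * r * (norm b)\<^sup>2"
    using sr by (intro add_mono mult_mono order_refl) (auto simp: abs_le_square_iff[symmetric])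
  also have "\<dots> = (norm b)\<^sup>2 * (3 * r + norm b)" by (simp add: field_simps)
  finally have "\<bar>s ^ 3 - r ^ 3 - 3 * r * (a \<bullet> b)\<bar> \<le> (norm b)\<^sup>2 * (3 * r + norm b)"
    unfolding eq using sr by simp
  then show ?thesis by (simp add: s_def r_def)
qed

text \<open>Two first-order expansions at 1 multiply to one whose linear part is the sum.
  \<open>M\<close> and \<open>N\<close> control the linear parts, \<open>P\<close> and
  \<open>Q\<close> the errors; M * N comes from the product of the linear parts.\<close>

lemma abs_mult_expansion_le:
  fixes x y a b \<kappa> :: real
  assumes "0 \<le> \<kappa>" "\<kappa> \<le> 1" "\<bar>a\<bar> \<le> M * \<kappa>" "\<bar>b\<bar> \<le> N * \<kappa>"
    "\<bar>x - 1 - a\<bar> \<le> P * \<kappa>\<^sup>2" "\<bar>y - 1 - b\<bar> \<le> Q * \<kappa>\<^sup>2" "0 \<le> M" "0 \<le> N" "0 \<le> P" "0 \<le> Q"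
  shows "\<bar>x * y - 1 - (a + b)\<bar> \<le> (M * N + P * (1 + N + Q) + Q * (1 + M)) * \<kappa>\<^sup>2"
proof -
  define e f where "e = x - 1 - a" and "f = y - 1 - b"
  have e: "\<bar>e\<bar> \<le> P * \<kappa>\<^sup>2" and f: "\<bar>f\<bar> \<le> Q * \<kappa>\<^sup>2" using assms by (auto simp: e_def f_def)
  have k2: "\<kappa>\<^sup>2 \<le> 1" using assms by (simp add: power_le_one)
  have f1: "\<bar>f\<bar> \<le> Q" using f mult_left_mono[OF k2 \<open>0 \<le> Q\<close>] by simp
  have a1: "\<bar>a\<bar> \<le> M" "\<bar>b\<bar> \<le> N"
    using assms(3,4) mult_left_mono[OF assms(2) \<open>0 \<le> M\<close>] mult_left_mono[OF assms(2) \<open>0 \<le> N\<close>] by auto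
  have s: "\<bar>1 + b + f\<bar> \<le> 1 + N + Q" "\<bar>1 + a\<bar> \<le> 1 + M" using a1 f1 by linarith+
  have eq: "x * y - 1 - (a + b) = a * b + e * (1 + b + f) + f * (1 + a)"
    by (simp add: e_def f_def algebra_simps)
  have "\<bar>x * y - 1 - (a + b)\<bar> \<le> \<bar>a\<bar> * \<bar>b\<bar> + \<bar>e\<bar> * \<bar>1 + b + f\<bar> + \<bar>f\<bar> * \<bar>1 + a\<bar>"
    unfolding eq abs_mult[symmetric] by linarith
  also have "\<dots> \<le> (M * \<kappa>) * (N * \<kappa>) + P * \<kappa>\<^sup>2 * (1 + N + Q) + Q * \<kappa>\<^sup>2 * (1 + M)"
    by (intro add_mono mult_mono assms e f s abs_ge_zero mult_nonneg_nonneg zero_le_power2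
        order.trans[OF abs_ge_zero s(1)] order.trans[OF abs_ge_zero s(2)])
  also have "\<dots> = (M * N + P * (1 + N + Q) + Q * (1 + M)) * \<kappa>\<^sup>2"
    by (simp add: power2_eq_square algebra_simps)
  finally show ?thesis .
qed

text \<open>The left-hand expression is the cubed length of the gradient times the volume density
  for the metric \<open>mat 1 + A\<close>, with \<open>w\<close> the Euclidean gradient. By
  homogeneity, division by \<open>norm w ^ 3\<close> reduces it to scalar expansions at 1, one for
  the normalized inverse quadratic form and one for the determinant.\<close>

lemma energy_density_expansion:
  fixes A :: "real^3^3"
  assumes "norm A \<le> 1/24"
  shows "\<bar>sqrt (w \<bullet> (matrix_inv (mat 1 + A) *v w)) ^ 3 * sqrt (det (mat 1 + A))
      - norm w ^ 3 - (1/2 * trace A * norm w ^ 3 - 3/2 * norm w * (w \<bullet> (A *v w)))\<bar>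
    \<le> 1000 * (norm A)\<^sup>2 * norm w ^ 3"
proof (cases "w = 0")
  case True then show ?thesis by simp
next
  case False
  define r \<kappa> where "r = norm w" and "\<kappa> = norm A"
  have r: "r > 0" using False by (simp add: r_def)
  have k: "0 \<le> \<kappa>" "\<kappa> \<le> 1/24" "\<kappa> \<le> 1" using assms by (auto simp: \<kappa>_def)
  \<comment> \<open>This turns 12 * \<open>\<kappa>\<^sup>2\<close> into at most \<kappa>/2, so that
    below |z - 1| \<le> 2\<kappa> and |d - 1| \<le> 4\<kappa>; hence z lies in [0,2] and d is
    nonnegative.\<close>
  have k2: "\<kappa>\<^sup>2 \<le> 1/24 * \<kappa>" using k mult_right_mono[of \<kappa> "1/24" \<kappa>] by (simp add: power2_eq_square)
  define q where "q = w \<bullet> (matrix_inv (mat 1 + A) *v w)"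
  define c where "c = w \<bullet> (A *v w)"
  define z where "z = q / r\<^sup>2"
  have q: "\<bar>q - r\<^sup>2 + c\<bar> \<le> 2 * \<kappa>\<^sup>2 * r\<^sup>2"
    using quadratic_form_inverse_expansion[of A w] assms by (simp add: q_def r_def c_def \<kappa>_def)
  have c: "\<bar>c\<bar> \<le> \<kappa> * r\<^sup>2"
  proof -
    have "\<bar>c\<bar> \<le> norm w * norm (A *v w)" unfolding c_def by (rule Cauchy_Schwarz_ineq2)
    also have "\<dots> \<le> norm w * (norm A * norm w)"
      by (intro mult_left_mono norm_matrix_vector_mult_le) simp
    finally show ?thesis by (simp add: r_def \<kappa>_def power2_eq_square mult_ac)
  qed
  have c': "\<bar>c / r\<^sup>2\<bar> \<le> \<kappa>" using c r by (simp add: divide_le_eq)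
  have z1: "\<bar>z - 1 + c / r\<^sup>2\<bar> \<le> 2 * \<kappa>\<^sup>2"
  proof -
    have "z - 1 + c / r\<^sup>2 = (q - r\<^sup>2 + c) / r\<^sup>2" using r by (simp add: z_def field_simps)
    then show ?thesis using q r by (simp add: divide_le_eq abs_divide)
  qed
  have z2: "\<bar>z - 1\<bar> \<le> 2 * \<kappa>" using z1 c' k2 k by linarith
  then have z3: "0 \<le> z" "z \<le> 2" using k by linarith+
  have z4: "(z - 1)\<^sup>2 \<le> 4 * \<kappa>\<^sup>2" using power_mono[OF z2, of 2] by (simp add: power_mult_distrib)
  \<comment> \<open>15 = 3 * 4 + 3: the error of the cubed root, where |z - 1| \<le> 2\<kappa>, and
    3/2 times the error 2 of the Neumann step.\<close>
  have x: "\<bar>sqrt z ^ 3 - 1 - (- 3/2 * (c / r\<^sup>2))\<bar> \<le> 15 * \<kappa>\<^sup>2"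
  proof -
    have "sqrt z ^ 3 - 1 - (- 3/2 * (c / r\<^sup>2))
        = (sqrt z ^ 3 - 1 - 3/2 * (z - 1)) + 3/2 * (z - 1 + c / r\<^sup>2)"
      by (simp add: field_simps)
    moreover have "\<bar>3/2 * (z - 1 + c / r\<^sup>2)\<bar> \<le> 3 * \<kappa>\<^sup>2" using z1 by (simp add: abs_mult)
    ultimately show ?thesis using sqrt_cubed_expansion_at_1[OF z3] z4 by linarith
  qed
  define d where "d = det (mat 1 + A)"
  have d: "\<bar>d - 1 - trace A\<bar> \<le> 12 * \<kappa>\<^sup>2"
    using det_mat_1_plus_3[of A] assms by (simp add: d_def \<kappa>_def)
  have t: "\<bar>trace A\<bar> \<le> 3 * \<kappa>" unfolding \<kappa>_def by (rule abs_trace_le_3)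
  have d2: "\<bar>d - 1\<bar> \<le> 4 * \<kappa>" using d t k2 k by linarith
  then have d3: "0 \<le> d" using k by linarith
  have d4: "(d - 1)\<^sup>2 \<le> 16 * \<kappa>\<^sup>2" using power_mono[OF d2, of 2] by (simp add: power_mult_distrib)
  \<comment> \<open>22 = 16 + 6: the error of the root, where |d - 1| \<le> 4\<kappa>, and half of
    the 12 from the determinant.\<close>
  have y: "\<bar>sqrt d - 1 - trace A / 2\<bar> \<le> 22 * \<kappa>\<^sup>2"
  proof -
    have "sqrt d - 1 - trace A / 2 = (sqrt d - 1 - (d - 1) / 2) + (d - 1 - trace A) / 2"
      by (simp add: field_simps)
    moreover have "\<bar>(d - 1 - trace A) / 2\<bar> \<le> 6 * \<kappa>\<^sup>2" using d by simp
    ultimately show ?thesis using sqrt_expansion_at_1[OF d3] d4 by linarith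
  qed
  have c'': "\<bar>- 3/2 * (c / r\<^sup>2)\<bar> \<le> 3/2 * \<kappa>" using c' by (simp only: abs_mult)
  have t': "\<bar>trace A / 2\<bar> \<le> 3/2 * \<kappa>" using t by simp
  have "\<bar>sqrt z ^ 3 * sqrt d - 1 - (- 3/2 * (c / r\<^sup>2) + trace A / 2)\<bar>
      \<le> (3/2 * (3/2) + 15 * (1 + 3/2 + 22) + 22 * (1 + 3/2)) * \<kappa>\<^sup>2"
    by (rule abs_mult_expansion_le[OF k(1,3) c'' t' x y]) simp_all
  \<comment> \<open>The bracket equals 424.75; 1000 is a round upper bound.\<close>
  also have "\<dots> \<le> 1000 * \<kappa>\<^sup>2" by simp
  finally have "\<bar>(sqrt z ^ 3 * sqrt d - 1 - (- 3/2 * (c / r\<^sup>2) + trace A / 2)) * r ^ 3\<bar>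
      \<le> 1000 * \<kappa>\<^sup>2 * r ^ 3"
    unfolding abs_mult using r by (intro mult_mono) auto
  moreover have "(sqrt z ^ 3 * sqrt d - 1 - (- 3/2 * (c / r\<^sup>2) + trace A / 2)) * r ^ 3
    = sqrt q ^ 3 * sqrt d - r ^ 3 - (1/2 * trace A * r ^ 3 - 3/2 * r * c)"
  proof -
    have sq: "sqrt q = sqrt z * r" using r z3 by (simp add: z_def real_sqrt_divide)
    have re: "c / r\<^sup>2 * r ^ 3 = r * c" using r by (simp add: power2_eq_square power3_eq_cube)
    have "(X * D - 1 - (- 3/2 * E + T / 2)) * R = X * R * D - R - (1/2 * T * R - 3/2 * (E * R))"
      for X D E T R :: real by (simp add: field_simps)
    from this[of "sqrt z ^ 3" "sqrt d" "c / r\<^sup>2" "trace A" "r ^ 3"] show ?thesis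
      by (simp only: sq re power_mult_distrib mult.assoc[of "3/2" r c])
  qed
  ultimately show ?thesis by (simp add: q_def c_def d_def r_def \<kappa>_def)
qed

text \<open>The expansion in the metric leaves its linear term at the gradient \<open>a + b\<close>,
  whereas the linearization has it at \<open>a\<close>. Moving it costs a factor
  \<open>norm b\<close>, and together with \<open>norm A\<close> this is already of second
  order.\<close>

lemma cubic_form_difference:
  fixes A :: "real^3^3"
  shows "\<bar>(1/2 * trace A * norm (a + b) ^ 3 - 3/2 * norm (a + b) * ((a + b) \<bullet> (A *v (a + b))))
      - (1/2 * trace A * norm a ^ 3 - 3/2 * norm a * (a \<bullet> (A *v a)))\<bar>
    \<le> 9 * norm A * norm b * (norm a + norm b)\<^sup>2"
proof -
  define s r \<kappa> where "s = norm (a + b)" and "r = norm a" and "\<kappa> = norm A"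
  have pos: "0 \<le> s" "0 \<le> r" "0 \<le> \<kappa>" by (auto simp: s_def r_def \<kappa>_def)
  have sr: "\<bar>s - r\<bar> \<le> norm b" "s \<le> r + norm b"
    using norm_triangle_ineq3[of "a + b" a] norm_triangle_ineq[of a b] by (auto simp: s_def r_def)
  have form: "\<bar>x \<bullet> (A *v y)\<bar> \<le> \<kappa> * (norm x * norm y)" for x y
  proof -
    have "\<bar>x \<bullet> (A *v y)\<bar> \<le> norm x * norm (A *v y)" by (rule Cauchy_Schwarz_ineq2)
    also have "\<dots> \<le> norm x * (norm A * norm y)"
      by (intro mult_left_mono norm_matrix_vector_mult_le) simp
    finally show ?thesis by (simp add: \<kappa>_def mult_ac)
  qed
  define m where "m = r + norm b"
  have m: "s \<le> m" "r \<le> m" "0 \<le> m" using sr pos by (auto simp: m_def)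
  have quad: "s\<^sup>2 + r * s + r\<^sup>2 \<le> 3 * m\<^sup>2"
    using power_mono[OF m(1) pos(1), of 2] power_mono[OF m(2) pos(2), of 2]
      mult_mono[OF m(2,1) m(3) pos(1)] by (simp add: power2_eq_square)
  have cube: "\<bar>s ^ 3 - r ^ 3\<bar> \<le> norm b * (3 * m\<^sup>2)"
  proof -
    have eq: "s ^ 3 - r ^ 3 = (s - r) * (s\<^sup>2 + r * s + r\<^sup>2)"
      by (simp add: power2_eq_square power3_eq_cube algebra_simps)
    show ?thesis unfolding eq abs_mult
      using sr quad pos by (intro mult_mono) auto
  qed
  have form3: "\<bar>s * ((a + b) \<bullet> (A *v (a + b))) - r * (a \<bullet> (A *v a))\<bar> \<le> \<kappa> * (norm b * (3 * m\<^sup>2))"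
  proof -
    have eq: "s * ((a + b) \<bullet> (A *v (a + b))) - r * (a \<bullet> (A *v a))
        = (s - r) * ((a + b) \<bullet> (A *v (a + b))) + r * (b \<bullet> (A *v (a + b)) + a \<bullet> (A *v b))"
      by (simp add: matrix_vector_right_distrib inner_add algebra_simps)
    have "\<bar>(s - r) * ((a + b) \<bullet> (A *v (a + b)))\<bar> \<le> norm b * (\<kappa> * (s * s))"
      unfolding abs_mult using form[of "a + b" "a + b"] sr pos by (intro mult_mono) (auto simp: s_def)
    moreover have "\<bar>r * (b \<bullet> (A *v (a + b)) + a \<bullet> (A *v b))\<bar> \<le> r * (\<kappa> * (norm b * s) + \<kappa> * (r * norm b))"
      unfolding abs_mult using form[of b "a + b"] form[of a b] pos
      by (intro mult_mono) (auto simp: s_def r_def)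
    moreover have "norm b * (\<kappa> * (s * s)) + r * (\<kappa> * (norm b * s) + \<kappa> * (r * norm b))
        = \<kappa> * (norm b * (s\<^sup>2 + r * s + r\<^sup>2))"
      by (simp add: power2_eq_square algebra_simps)
    moreover have "\<kappa> * (norm b * (s\<^sup>2 + r * s + r\<^sup>2)) \<le> \<kappa> * (norm b * (3 * m\<^sup>2))"
      using quad pos by (intro mult_left_mono) auto
    ultimately show ?thesis unfolding eq by linarith
  qed
  have trace3: "\<bar>trace A * (s ^ 3 - r ^ 3)\<bar> \<le> (3 * \<kappa>) * (norm b * (3 * m\<^sup>2))"
    unfolding abs_mult using abs_trace_le_3[of A] cube pos by (intro mult_mono) (auto simp: \<kappa>_def)
  have eq: "(1/2 * trace A * s ^ 3 - 3/2 * s * ((a + b) \<bullet> (A *v (a + b))))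
      - (1/2 * trace A * r ^ 3 - 3/2 * r * (a \<bullet> (A *v a)))
    = 1/2 * (trace A * (s ^ 3 - r ^ 3)) - 3/2 * (s * ((a + b) \<bullet> (A *v (a + b))) - r * (a \<bullet> (A *v a)))"
    by (simp add: field_simps)
  \<comment> \<open>The trace part carries 3 * 3 and the quadratic form part 3, so that 9 = 1/2 * 9
    + 3/2 * 3.\<close>
  have combine: "\<bar>1/2 * x - 3/2 * y\<bar> \<le> 9 * z" if "\<bar>x\<bar> \<le> 9 * z" "\<bar>y\<bar> \<le> 3 * z" for x y z :: real
    using that by linarith
  have "\<bar>1/2 * (trace A * (s ^ 3 - r ^ 3))
      - 3/2 * (s * ((a + b) \<bullet> (A *v (a + b))) - r * (a \<bullet> (A *v a)))\<bar> \<le> 9 * (\<kappa> * (norm b * m\<^sup>2))"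
  proof (rule combine)
    show "\<bar>trace A * (s ^ 3 - r ^ 3)\<bar> \<le> 9 * (\<kappa> * (norm b * m\<^sup>2))"
      using trace3 by (simp only: mult_ac)
    show "\<bar>s * ((a + b) \<bullet> (A *v (a + b))) - r * (a \<bullet> (A *v a))\<bar> \<le> 3 * (\<kappa> * (norm b * m\<^sup>2))"
      using form3 by (simp only: mult_ac)
  qed
  then show ?thesis
    unfolding eq[symmetric] by (simp only: s_def r_def \<kappa>_def m_def mult.assoc)
qed

lemma cubic_form_bound:
  fixes A :: "real^3^3"
  shows "\<bar>1/2 * trace A * norm a ^ 3 - 3/2 * norm a * (a \<bullet> (A *v a))\<bar> \<le> 9 * norm A * norm a ^ 3"
  using cubic_form_difference[of A 0 a] by (simp add: power2_eq_square power3_eq_cube mult_ac)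

text \<open>Here \<open>f'\<close> is just a function for which the Taylor estimate holds at the
  point in question. The three geometric replacements keep the factor f (r + v), which is merely
  bounded; the passage to f r then meets only the terms at \<open>a\<close>, whose growth in
  \<open>b\<close> is at most linear.\<close>

lemma remainder_pointwise_bound:
  fixes f f' :: "real \<Rightarrow> real" and A :: "real^3^3"
  assumes "\<bar>f (r + v)\<bar> \<le> B" "\<bar>f (r + v) - f r\<bar> \<le> B * \<bar>v\<bar>"
    "\<bar>f (r + v) - f r - f' r * v\<bar> \<le> B * v\<^sup>2"
    and a: "norm a \<le> \<alpha>" and A: "norm A \<le> \<kappa>" and \<kappa>: "\<kappa> \<le> 1/24"
  shows "\<bar>f (r + v) * sqrt ((a + b) \<bullet> (matrix_inv (mat 1 + A) *v (a + b))) ^ 3 * sqrt (det (mat 1 + A))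
      - (f r * norm a ^ 3 + f' r * norm a ^ 3 * v + 3 * (f r * norm a * (a \<bullet> b))
         + f r * (1/2 * trace A * norm a ^ 3 - 3/2 * norm a * (a \<bullet> (A *v a))))\<bar>
    \<le> 20000 * B * (1 + \<alpha>) ^ 3 * (\<kappa>\<^sup>2 + v\<^sup>2 + (norm b)\<^sup>2 + norm b ^ 3)"
proof -
  define \<beta> where "\<beta> = norm b"
  define Q where "Q = \<kappa>\<^sup>2 + v\<^sup>2 + \<beta>\<^sup>2 + \<beta> ^ 3"
  define E where "E = sqrt ((a + b) \<bullet> (matrix_inv (mat 1 + A) *v (a + b))) ^ 3 * sqrt (det (mat 1 + A))"
  define G where "G w = 1/2 * trace A * norm w ^ 3 - 3/2 * norm w * (w \<bullet> (A *v w))" for w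
  have pos: "0 \<le> \<beta>" "0 \<le> \<alpha>" "0 \<le> \<kappa>" "0 \<le> B"
    using order_trans[OF norm_ge_zero a] order_trans[OF norm_ge_zero A] order_trans[OF abs_ge_zero assms(1)]
    by (simp_all add: \<beta>_def)
  \<comment> \<open>The added 1 makes the powers of \<open>m\<close> increasing, so that every lower
    power of \<open>norm a\<close> is absorbed in \<open>m ^ 3\<close>.\<close>
  define m where "m = 1 + \<alpha>"
  have m: "1 \<le> m" "\<alpha> \<le> m" "0 \<le> m" using pos by (auto simp: m_def)
  have mp: "1 \<le> m ^ 3" "m \<le> m ^ 3" "m\<^sup>2 \<le> m ^ 3"
    using m(1) power_increasing[of 0 3 m] power_increasing[of 1 3 m] power_increasing[of 2 3 m] by auto
  have \<alpha>p: "norm a \<le> m" "(norm a)\<^sup>2 \<le> m\<^sup>2" "norm a ^ 3 \<le> m ^ 3"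
    using a m power_mono[of "norm a" m] by auto
  have Q: "\<kappa>\<^sup>2 \<le> Q" "v\<^sup>2 \<le> Q" "\<beta>\<^sup>2 \<le> Q" "\<beta> ^ 3 \<le> Q" "0 \<le> Q" "\<kappa>\<^sup>2 + \<beta> ^ 3 \<le> Q"
      "\<beta>\<^sup>2 + \<beta> ^ 3 \<le> Q" "\<kappa>\<^sup>2 + \<beta>\<^sup>2 + \<beta> ^ 3 \<le> Q" "v\<^sup>2 + \<beta>\<^sup>2 \<le> Q" "v\<^sup>2 + \<kappa>\<^sup>2 \<le> Q"
    using pos by (auto simp: Q_def)
  \<comment> \<open>Turns mixed products such as \<kappa>\<beta> and |v|\<beta> into the pure
    squares collected in \<open>Q\<close>.\<close>
  have young: "2 * (x * y) \<le> x\<^sup>2 + y\<^sup>2" for x y :: real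
    using zero_le_power2[of "x - y"] by (simp add: power2_diff)
  have ab: "norm (a + b) \<le> m + \<beta>"
    using norm_triangle_ineq[of a b] \<alpha>p by (simp add: \<beta>_def)
  have ab3: "norm (a + b) ^ 3 \<le> 8 * (m ^ 3 + \<beta> ^ 3)"
  proof -
    have "norm (a + b) ^ 3 \<le> (2 * max m \<beta>) ^ 3" using ab by (intro power_mono) auto
    also have "\<dots> \<le> 8 * (m ^ 3 + \<beta> ^ 3)" using m pos by (auto simp: max_def power_mult_distrib)
    finally show ?thesis .
  qed
  have \<kappa>2: "\<kappa>\<^sup>2 \<le> 1" using pos \<kappa> by (simp add: power_le_one)
  have t1: "\<bar>f (r + v) * (E - norm (a + b) ^ 3 - G (a + b))\<bar> \<le> B * (8000 * (m ^ 3 * Q))"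
  proof -
    have "\<bar>E - norm (a + b) ^ 3 - G (a + b)\<bar> \<le> 1000 * (norm A)\<^sup>2 * norm (a + b) ^ 3"
      unfolding E_def G_def using A \<kappa> by (intro energy_density_expansion) auto
    also have "\<dots> \<le> 1000 * \<kappa>\<^sup>2 * (8 * (m ^ 3 + \<beta> ^ 3))"
      using A ab3 pos by (intro mult_mono power_mono) auto
    also have "\<dots> = 8000 * (\<kappa>\<^sup>2 * m ^ 3 + \<kappa>\<^sup>2 * \<beta> ^ 3)" by (simp add: algebra_simps)
    also have "\<dots> \<le> 8000 * (\<kappa>\<^sup>2 * m ^ 3 + m ^ 3 * \<beta> ^ 3)"
      using \<kappa>2 mp pos by (intro mult_left_mono add_left_mono mult_right_mono) auto
    also have "\<dots> = 8000 * (m ^ 3 * (\<kappa>\<^sup>2 + \<beta> ^ 3))" by (simp add: algebra_simps)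
    also have "\<dots> \<le> 8000 * (m ^ 3 * Q)" using Q m by (intro mult_left_mono) auto
    finally show ?thesis unfolding abs_mult using assms(1) pos by (intro mult_mono) auto
  qed
  have t2: "\<bar>f (r + v) * (norm (a + b) ^ 3 - norm a ^ 3 - 3 * norm a * (a \<bullet> b))\<bar> \<le> B * (3 * (m ^ 3 * Q))"
  proof -
    have "\<bar>norm (a + b) ^ 3 - norm a ^ 3 - 3 * norm a * (a \<bullet> b)\<bar> \<le> \<beta>\<^sup>2 * (3 * norm a + \<beta>)"
      unfolding \<beta>_def by (rule norm_add_cubed_expansion)
    also have "\<dots> = norm a * (3 * \<beta>\<^sup>2) + 1 * \<beta> ^ 3"
      by (simp add: power2_eq_square power3_eq_cube algebra_simps)
    also have "\<dots> \<le> m ^ 3 * (3 * \<beta>\<^sup>2) + m ^ 3 * \<beta> ^ 3"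
      using \<alpha>p mp pos by (intro add_mono mult_right_mono) auto
    also have "\<dots> = m ^ 3 * (3 * \<beta>\<^sup>2 + \<beta> ^ 3)" by (simp add: algebra_simps)
    also have "\<dots> \<le> m ^ 3 * (3 * Q)" using Q m pos zero_le_power[of \<beta> 3] by (intro mult_left_mono) auto
    finally show ?thesis unfolding abs_mult using assms(1) pos by (intro mult_mono) auto
  qed
  have t3: "\<bar>f (r + v) * (G (a + b) - G a)\<bar> \<le> B * (18 * (m ^ 3 * Q))"
  proof -
    have "\<bar>G (a + b) - G a\<bar> \<le> 9 * norm A * \<beta> * (norm a + \<beta>)\<^sup>2"
      unfolding G_def \<beta>_def by (rule cubic_form_difference)
    also have "\<dots> \<le> 9 * \<kappa> * \<beta> * (m + \<beta>)\<^sup>2"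
      using A \<alpha>p pos by (intro mult_mono power_mono) auto
    also have "\<dots> \<le> 9 * \<kappa> * \<beta> * (2 * (m\<^sup>2 + \<beta>\<^sup>2))"
      using young[of m \<beta>] pos by (intro mult_left_mono) (auto simp: power2_sum)
    also have "\<dots> = 9 * m\<^sup>2 * (2 * (\<kappa> * \<beta>)) + \<kappa> * (18 * \<beta> ^ 3)"
      by (simp add: power2_eq_square power3_eq_cube algebra_simps)
    also have "\<dots> \<le> 9 * m ^ 3 * (\<kappa>\<^sup>2 + \<beta>\<^sup>2) + m ^ 3 * (18 * \<beta> ^ 3)"
      using young[of \<kappa> \<beta>] mp m pos \<kappa> by (intro add_mono mult_mono) auto
    also have "\<dots> = m ^ 3 * (9 * (\<kappa>\<^sup>2 + \<beta>\<^sup>2) + 18 * \<beta> ^ 3)" by (simp add: algebra_simps)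
    also have "\<dots> \<le> m ^ 3 * (18 * Q)"
    proof (rule mult_left_mono)
      show "9 * (\<kappa>\<^sup>2 + \<beta>\<^sup>2) + 18 * \<beta> ^ 3 \<le> 18 * Q"
        using Q(8) zero_le_power2[of \<kappa>] zero_le_power2[of \<beta>] by argo
    qed (use m in simp)
    finally show ?thesis unfolding abs_mult using assms(1) pos by (intro mult_mono) auto
  qed
  have t4: "\<bar>(f (r + v) - f r - f' r * v) * norm a ^ 3\<bar> \<le> B * (m ^ 3 * Q)"
  proof -
    have "\<bar>(f (r + v) - f r - f' r * v) * norm a ^ 3\<bar> \<le> (B * v\<^sup>2) * m ^ 3"
      unfolding abs_mult using assms(3) \<alpha>p pos by (intro mult_mono) auto
    also have "\<dots> = B * (m ^ 3 * v\<^sup>2)" by simp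
    also have "\<dots> \<le> B * (m ^ 3 * Q)" using Q pos m by (intro mult_left_mono) auto
    finally show ?thesis .
  qed
  have t5: "\<bar>(f (r + v) - f r) * (3 * norm a * (a \<bullet> b) + G a)\<bar> \<le> B * (6 * (m ^ 3 * Q))"
  proof -
    have "\<bar>3 * norm a * (a \<bullet> b)\<bar> \<le> 3 * norm a * (norm a * \<beta>)"
      unfolding abs_mult using Cauchy_Schwarz_ineq2[of a b] by (intro mult_mono) (auto simp: \<beta>_def)
    also have "\<dots> = 3 * (norm a)\<^sup>2 * \<beta>" by (simp add: power2_eq_square)
    also have "\<dots> \<le> 3 * m ^ 3 * \<beta>" using order_trans[OF \<alpha>p(2) mp(3)] pos by (intro mult_right_mono) auto
    finally have g1: "\<bar>3 * norm a * (a \<bullet> b)\<bar> \<le> 3 * m ^ 3 * \<beta>" .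
    have "\<bar>G a\<bar> \<le> 9 * norm A * norm a ^ 3" unfolding G_def by (rule cubic_form_bound)
    also have "\<dots> \<le> 9 * \<kappa> * m ^ 3" using A \<alpha>p m pos by (intro mult_mono) auto
    finally have "\<bar>3 * norm a * (a \<bullet> b) + G a\<bar> \<le> m ^ 3 * (3 * \<beta> + 9 * \<kappa>)"
      using g1 by (simp add: algebra_simps)
    then have "\<bar>(f (r + v) - f r) * (3 * norm a * (a \<bullet> b) + G a)\<bar> \<le> (B * \<bar>v\<bar>) * (m ^ 3 * (3 * \<beta> + 9 * \<kappa>))"
      unfolding abs_mult using assms(2) pos by (intro mult_mono) auto
    also have "\<dots> = B * (m ^ 3 * (3/2 * (2 * (\<bar>v\<bar> * \<beta>)) + 9/2 * (2 * (\<bar>v\<bar> * \<kappa>))))"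
      by (simp add: field_simps)
    also have "\<dots> \<le> B * (m ^ 3 * (6 * Q))"
    proof -
      have "2 * (\<bar>v\<bar> * \<beta>) \<le> Q" "2 * (\<bar>v\<bar> * \<kappa>) \<le> Q"
        using young[of "\<bar>v\<bar>" \<beta>] young[of "\<bar>v\<bar>" \<kappa>] Q(9,10) by auto
      then have "3/2 * (2 * (\<bar>v\<bar> * \<beta>)) + 9/2 * (2 * (\<bar>v\<bar> * \<kappa>)) \<le> 6 * Q" by linarith
      then show ?thesis using pos m by (intro mult_left_mono) auto
    qed
    finally show ?thesis by simp
  qed
  \<comment> \<open>Telescoping: metric expansion at \<open>a + b\<close>, expansion of the cubed
    length, transport of the linear term to \<open>a\<close>, Taylor remainder of \<open>f\<close>
    on the zeroth-order term, and the increment of \<open>f\<close> on the first-order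
    terms.\<close>
  have split: "f (r + v) * E - (f r * norm a ^ 3 + f' r * norm a ^ 3 * v + 3 * (f r * norm a * (a \<bullet> b)) + f r * G a)
    = f (r + v) * (E - norm (a + b) ^ 3 - G (a + b))
      + f (r + v) * (norm (a + b) ^ 3 - norm a ^ 3 - 3 * norm a * (a \<bullet> b))
      + f (r + v) * (G (a + b) - G a)
      + (f (r + v) - f r - f' r * v) * norm a ^ 3
      + (f (r + v) - f r) * (3 * norm a * (a \<bullet> b) + G a)"
    by (simp add: algebra_simps)
  \<comment> \<open>The five constants add up to 8028.\<close>
  have sum5: "\<bar>x1 + x2 + x3 + x4 + x5\<bar> \<le> 20000 * z"
    if "\<bar>x1\<bar> \<le> 8000 * z" "\<bar>x2\<bar> \<le> 3 * z" "\<bar>x3\<bar> \<le> 18 * z" "\<bar>x4\<bar> \<le> z" "\<bar>x5\<bar> \<le> 6 * z"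
    for x1 x2 x3 x4 x5 z :: real
    using that by linarith
  have "\<bar>f (r + v) * E - (f r * norm a ^ 3 + f' r * norm a ^ 3 * v + 3 * (f r * norm a * (a \<bullet> b)) + f r * G a)\<bar>
    \<le> 20000 * (B * (m ^ 3 * Q))"
    unfolding split using t1 t2 t3 t4 t5 by (intro sum5) simp_all
  then show ?thesis by (simp only: E_def G_def Q_def m_def \<beta>_def mult.assoc)
qed

section \<open>Calculus of \<open>C\<^sup>k\<close> functions\<close>

text \<open>Uniqueness of the derivative allows any explicit \<open>F\<close> in place of
  \<open>frechet_derivative\<close>, so the usual differentiation rules can drive the
  inductions.\<close>

lemma Ck_SucI:
  assumes "\<And>x. (f has_derivative F x) (at x)" "\<And>i. i \<in> Basis \<Longrightarrow> Ck n (\<lambda>x. F x i)"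
  shows "Ck (Suc n) f"
proof -
  have "frechet_derivative f (at x) = F x" for x
    using frechet_derivative_at[OF assms(1)] by simp
  with assms show ?thesis by (auto simp: differentiable_def)
qed

lemma Ck_SucE:
  assumes "Ck (Suc n) f"
  obtains F where "\<And>x. (f has_derivative F x) (at x)" "\<And>i. i \<in> Basis \<Longrightarrow> Ck n (\<lambda>x. F x i)"
  using assms that[of "\<lambda>x. frechet_derivative f (at x)"] by (auto simp: frechet_derivative_works)

lemma Ck_SucD: "Ck (Suc n) f \<Longrightarrow> Ck n f"
proof (induction n arbitrary: f)
  case 0
  then show ?case
    by (auto simp: continuous_on_eq_continuous_at intro: differentiable_imp_continuous_within)
next
  case (Suc n)
  then show ?case by (metis Ck.simps(2))
qed

lemma Ck_le: "m \<le> n \<Longrightarrow> Ck n f \<Longrightarrow> Ck m f"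
  by (induction n rule: dec_induct) (auto dest: Ck_SucD simp del: Ck.simps)

lemma Ck_continuous: "Ck n f \<Longrightarrow> continuous_on UNIV f"
  using Ck_le[of 0 n f] by simp

lemma Ck_const: "Ck n (\<lambda>x. c)"
proof (induction n arbitrary: c)
  case (Suc n)
  show ?case by (rule Ck_SucI[where F = "\<lambda>x h. 0"]) (auto simp: Suc.IH)
qed auto

lemma Ck_add: "Ck n f \<Longrightarrow> Ck n g \<Longrightarrow> Ck n (\<lambda>x. f x + g x)"
proof (induction n arbitrary: f g)
  case 0 then show ?case by (auto intro: continuous_intros)
next
  case (Suc n)
  obtain F where F: "\<And>x. (f has_derivative F x) (at x)" "\<And>i. i \<in> Basis \<Longrightarrow> Ck n (\<lambda>x. F x i)"
    using Suc.prems(1) by (rule Ck_SucE) blast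
  obtain G where G: "\<And>x. (g has_derivative G x) (at x)" "\<And>i. i \<in> Basis \<Longrightarrow> Ck n (\<lambda>x. G x i)"
    using Suc.prems(2) by (rule Ck_SucE) blast
  show ?case
    by (rule Ck_SucI[OF has_derivative_add[OF F(1) G(1)]]) (intro Suc.IH F G)
qed

lemma Ck_mult: "Ck n f \<Longrightarrow> Ck n g \<Longrightarrow> Ck n (\<lambda>x. f x * g x)"
proof (induction n arbitrary: f g)
  case 0 then show ?case by (auto intro: continuous_intros)
next
  case (Suc n)
  obtain F where F: "\<And>x. (f has_derivative F x) (at x)" "\<And>i. i \<in> Basis \<Longrightarrow> Ck n (\<lambda>x. F x i)"
    using Suc.prems(1) by (rule Ck_SucE) blast
  obtain G where G: "\<And>x. (g has_derivative G x) (at x)" "\<And>i. i \<in> Basis \<Longrightarrow> Ck n (\<lambda>x. G x i)"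
    using Suc.prems(2) by (rule Ck_SucE) blast
  show ?case
    by (rule Ck_SucI[OF has_derivative_mult[OF F(1) G(1)]])
      (intro Ck_add Suc.IH F G Suc.prems[THEN Ck_SucD])
qed

lemma Ck_prod: "(\<And>i. i \<in> I \<Longrightarrow> Ck n (f i)) \<Longrightarrow> Ck n (\<lambda>x. \<Prod>i\<in>I. f i x)"
  by (induction I rule: infinite_finite_induct) (auto intro: Ck_mult Ck_const)

lemma Ck_real_SucI:
  fixes f :: "real \<Rightarrow> real"
  assumes "\<And>x. (f has_real_derivative f' x) (at x)" "Ck n f'"
  shows "Ck (Suc n) f"
  using assms by (intro Ck_SucI[of f "\<lambda>x. (*) (f' x)"]) (auto simp: has_field_derivative_def)

lemma Ck_real_SucE:
  fixes f :: "real \<Rightarrow> real"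
  assumes "Ck (Suc n) f"
  obtains "\<And>x. (f has_real_derivative deriv f x) (at x)" "Ck n (deriv f)"
proof -
  obtain F where F: "\<And>x. (f has_derivative F x) (at x)" "\<And>i. i \<in> Basis \<Longrightarrow> Ck n (\<lambda>x. F x i)"
    using assms by (rule Ck_SucE) blast
  have "F x = (*) (F x 1)" for x
  proof
    show "F x h = F x 1 * h" for h
      using linear_cmul[OF has_derivative_linear[OF F(1)[of x]], of h 1] by simp
  qed
  then have D: "(f has_real_derivative F x 1) (at x)" for x
    using F(1)[of x] by (simp add: has_field_derivative_def)
  then have "deriv f = (\<lambda>x. F x 1)" by (auto intro!: DERIV_imp_deriv)
  with D F(2) show ?thesis by (intro that) auto
qed

text \<open>This is the form of the chain rule needed for products of one-variable cutoffs in the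
  coordinates. The induction closes because the derivative is again such a composition, times a
  constant.\<close>

lemma Ck_compose_affine_inner:
  fixes h :: "real \<Rightarrow> real" and j :: "'a::euclidean_space"
  shows "Ck n h \<Longrightarrow> Ck n (\<lambda>x. h (c * (x \<bullet> j) + d))"
proof (induction n arbitrary: h)
  case 0
  then show ?case
    by (auto intro!: continuous_intros continuous_on_compose2[of UNIV h])
next
  case (Suc n)
  from Suc.prems obtain D: "\<And>x. (h has_real_derivative deriv h x) (at x)" and C: "Ck n (deriv h)"
    by (rule Ck_real_SucE) blast
  have "((\<lambda>x. h (c * (x \<bullet> j) + d)) has_derivative
      (\<lambda>y. (c * (y \<bullet> j)) * deriv h (c * (x \<bullet> j) + d))) (at x)" for x
    by (rule DERIV_compose_FDERIV[OF D]) (auto intro!: derivative_eq_intros)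
  then show ?case
    by (rule Ck_SucI) (intro Ck_mult Suc.IH C Ck_const)
qed

section \<open>Supports, and smoothness of functions pulled back by the reciprocal\<close>

lemma compactly_supported_inE:
  assumes "compactly_supported_in U f"
  obtains K where "compact K" "K \<subseteq> U" "\<And>x. x \<notin> K \<Longrightarrow> f x = 0"
  using assms closure_subset[of "{x. f x \<noteq> 0}"] unfolding compactly_supported_in_def by blast

lemma compactly_supported_inI:
  assumes "compact K" "K \<subseteq> U" "\<And>x. x \<notin> K \<Longrightarrow> f x = 0"
  shows "compactly_supported_in U f"
proof -
  have "closure {x. f x \<noteq> 0} \<subseteq> K"
    using assms by (intro closure_minimal compact_imp_closed) auto
  moreover from this have "compact (closure {x. f x \<noteq> 0})"
    using compact_Int_closed[OF assms(1) closed_closure, of "{x. f x \<noteq> 0}"]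
    by (simp add: inf.absorb2)
  ultimately show ?thesis using assms(2) by (auto simp: compactly_supported_in_def)
qed

lemma has_derivative_zero_off_support:
  fixes f :: "'a::euclidean_space \<Rightarrow> real"
  assumes "(f has_derivative F) (at x)" "closed K" "\<And>y. y \<notin> K \<Longrightarrow> f y = 0" "x \<notin> K"
  shows "F = (\<lambda>h. 0)"
proof -
  have "((\<lambda>y. 0) has_derivative F) (at x)"
    using assms by (intro has_derivative_transform_within_open[OF assms(1), of "- K"]) auto
  then show ?thesis by (rule has_derivative_unique) auto
qed

text \<open>Only \<open>\<eta>\<close> vanishing off a compact subset of \<open>(0,1)\<close> is relevant, so that the junk values
  at \<open>t \<le> 0\<close> are all zero and the function is as smooth as \<open>\<eta>\<close> across \<open>t = 0\<close>.\<close>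

definition reciprocal_pullback :: "nat \<Rightarrow> real \<Rightarrow> (real \<Rightarrow> real) \<Rightarrow> real \<Rightarrow> real" where
  "reciprocal_pullback m c \<eta> t = \<eta> (c / t - 1) / t ^ m"

text \<open>For t > 0 the argument c / t - 1 lies in (0,1) exactly when c/2 < t < c.\<close>

lemma reciprocal_pullback_eq_0:
  assumes "compactly_supported_in {0<..<1} \<eta>" "c > 0" "t \<le> c / 2 \<or> c \<le> t"
  shows "reciprocal_pullback m c \<eta> t = 0"
proof -
  obtain K where K: "K \<subseteq> {0<..<1}" "\<And>x. x \<notin> K \<Longrightarrow> \<eta> x = 0"
    using assms(1) by (rule compactly_supported_inE) blast
  have "c / t - 1 \<notin> {0<..<1}"
  proof (cases "t > 0")
    case True
    with assms(2,3) show ?thesis by (auto simp: field_simps)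
  next
    \<comment> \<open>This includes t = 0, where c / t is 0 by convention and the argument becomes
      -1.\<close>
    case False
    then have "c / t \<le> 0" using assms(2) by (intro divide_nonneg_nonpos) auto
    then show ?thesis by simp
  qed
  with K show ?thesis unfolding reciprocal_pullback_def by (metis div_0 subsetD)
qed

text \<open>Differentiation stays within the family and only raises the exponent, which is why the
  exponent is a parameter: smoothness then follows by induction. Below c/2 the function is locally
  zero, which takes care of the singular point 0.\<close>

lemma has_derivative_reciprocal_pullback:
  assumes "compactly_supported_in {0<..<1} \<eta>" "c > 0"
    "\<And>s. (\<eta> has_real_derivative \<eta>' s) (at s)" "compactly_supported_in {0<..<1} \<eta>'"
  shows "(reciprocal_pullback m c \<eta> has_real_derivative
    (- c) * reciprocal_pullback (m + 2) c \<eta>' t + (- real m) * reciprocal_pullback (m + 1) c \<eta> t) (at t)"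
proof (cases "t < c / 2")
  case True
  have "((\<lambda>_. 0) has_real_derivative 0) (at t)" by simp
  then have "(reciprocal_pullback m c \<eta> has_real_derivative 0) (at t)"
    by (rule has_field_derivative_transform_within_open[of _ _ _ "{..<c/2}"])
      (use True assms in \<open>auto simp: reciprocal_pullback_eq_0\<close>)
  with True assms show ?thesis by (simp add: reciprocal_pullback_eq_0)
next
  case False
  with assms have t: "t > 0" by simp
  have D: "((\<lambda>t. \<eta> (c / t - 1)) has_real_derivative \<eta>' (c / t - 1) * (- c / t\<^sup>2)) (at t)"
    by (rule DERIV_chain2[OF assms(3)])
      (use t in \<open>auto intro!: derivative_eq_intros simp: power2_eq_square\<close>)
  have "(reciprocal_pullback m c \<eta> has_real_derivative
    (\<eta>' (c / t - 1) * (- c / t\<^sup>2) * t ^ m - \<eta> (c / t - 1) * (real m * t ^ (m - 1))) / (t ^ m * t ^ m)) (at t)"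
    unfolding reciprocal_pullback_def
    by (rule DERIV_divide[OF D]) (use t in \<open>auto intro!: derivative_eq_intros\<close>)
  moreover have "(\<eta>' (c / t - 1) * (- c / t\<^sup>2) * t ^ m - \<eta> (c / t - 1) * (real m * t ^ (m - 1))) / (t ^ m * t ^ m)
    = (- c) * reciprocal_pullback (m + 2) c \<eta>' t + (- real m) * reciprocal_pullback (m + 1) c \<eta> t"
    \<comment> \<open>The case split deals with the truncated exponent m - 1 at m = 0.\<close>
    using t by (cases m) (simp_all add: reciprocal_pullback_def field_simps power_add power2_eq_square)
  ultimately show ?thesis by (simp only:)
qed

lemma compactly_supported_in_deriv:
  fixes \<eta> :: "real \<Rightarrow> real"
  assumes "compactly_supported_in U \<eta>" "\<And>s. (\<eta> has_real_derivative \<eta>' s) (at s)"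
  shows "compactly_supported_in U \<eta>'"
proof -
  obtain K where K: "compact K" "K \<subseteq> U" "\<And>x. x \<notin> K \<Longrightarrow> \<eta> x = 0"
    using assms(1) by (rule compactly_supported_inE) blast
  have "\<eta>' x = 0" if "x \<notin> K" for x
    using has_derivative_zero_off_support[of \<eta> "(*) (\<eta>' x)" x K] assms(2)[of x] K that
    by (metis compact_imp_closed has_field_derivative_def mult.right_neutral)
  with K show ?thesis by (intro compactly_supported_inI)
qed

lemma Ck_reciprocal_pullback:
  assumes "c > 0"
  shows "Ck n \<eta> \<Longrightarrow> compactly_supported_in {0<..<1} \<eta> \<Longrightarrow> Ck n (reciprocal_pullback m c \<eta>)"
proof (induction n arbitrary: m \<eta>)
  case 0
  have "continuous_on {0<..} (reciprocal_pullback m c \<eta>)"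
    unfolding reciprocal_pullback_def using 0
    by (auto intro!: continuous_intros continuous_on_compose2[of UNIV \<eta>])
  moreover have "continuous_on {..<c/2} (reciprocal_pullback m c \<eta>)"
    using continuous_on_const[of "{..<c/2}" "0::real"]
    by (rule continuous_on_eq) (use assms 0 in \<open>auto simp: reciprocal_pullback_eq_0\<close>)
  \<comment> \<open>The two overlapping open sets cover the line: the formula is regular on one, and
    the function vanishes on the other.\<close>
  ultimately have "continuous_on ({0<..} \<union> {..<c/2}) (reciprocal_pullback m c \<eta>)"
    by (intro continuous_on_open_Un) auto
  also have "{0<..} \<union> {..<c/2} = UNIV" using assms by auto
  finally show ?case by simp
next
  case (Suc n)
  from Suc.prems(1) obtain D: "\<And>x. (\<eta> has_real_derivative deriv \<eta> x) (at x)" and C: "Ck n (deriv \<eta>)"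
    by (rule Ck_real_SucE) blast
  have S: "compactly_supported_in {0<..<1} (deriv \<eta>)"
    using Suc.prems(2) D by (rule compactly_supported_in_deriv)
  show ?case
    by (rule Ck_real_SucI[OF has_derivative_reciprocal_pullback[OF Suc.prems(2) assms D S]])
      (intro Ck_add Ck_mult Ck_const Suc.IH C S Suc.prems Ck_SucD[OF Suc.prems(1)])
qed

lemma phi_eq_reciprocal_pullback:
  "phi \<psi> t = 1/2 * reciprocal_pullback 3 (1/2) \<psi> t + (-1) * reciprocal_pullback 3 1 \<psi> t"
  by (simp add: phi_def reciprocal_pullback_def right_diff_distrib diff_divide_distrib)

lemma Ck_phi:
  assumes "test_function {0<..<1} \<psi>"
  shows "Ck n (phi \<psi>)"
  unfolding phi_eq_reciprocal_pullback[abs_def] using assms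
  by (intro Ck_add Ck_mult Ck_const Ck_reciprocal_pullback) (auto simp: test_function_def smooth_def)

text \<open>The two summands live in (1/4,1/2) and (1/2,1).\<close>

lemma compactly_supported_in_phi:
  assumes "test_function {0<..<1} \<psi>"
  shows "compactly_supported_in UNIV (phi \<psi>)"
  by (rule compactly_supported_inI[of "{1/4..1}"])
    (use assms in \<open>auto simp: phi_eq_reciprocal_pullback reciprocal_pullback_eq_0 test_function_def\<close>)

lemma bounded_continuous_compact_support:
  fixes f :: "'a::euclidean_space \<Rightarrow> real"
  assumes "continuous_on UNIV f" "compactly_supported_in U f"
  obtains B where "\<And>x. \<bar>f x\<bar> \<le> B"
proof -
  obtain K where K: "compact K" "\<And>x. x \<notin> K \<Longrightarrow> f x = 0"
    using assms(2) by (rule compactly_supported_inE) blast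
  have "compact (f ` K)" using K assms by (meson compact_continuous_image continuous_on_subset subset_UNIV)
  then obtain B where "\<And>x. x \<in> K \<Longrightarrow> \<bar>f x\<bar> \<le> B" using compact_imp_bounded bounded_real by (metis imageI)
  then have "\<bar>f x\<bar> \<le> \<bar>B\<bar>" for x using K(2)[of x] by (cases "x \<in> K") force+
  then show ?thesis using that by blast
qed

text \<open>The mean value inequality is applied to \<open>f\<close> minus its tangent line at t,
  whose derivative is at most B |h| between t and t + h. One \<open>B\<close> dominates
  \<open>f\<close> and its first two derivatives.\<close>

lemma C2_compact_support_Taylor:
  fixes f :: "real \<Rightarrow> real"
  assumes "Ck 2 f" "compactly_supported_in UNIV f"
  obtains B where "continuous_on UNIV (deriv f)" "\<And>t. \<bar>f t\<bar> \<le> B" "\<And>t. \<bar>deriv f t\<bar> \<le> B"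
    "\<And>t h. \<bar>f (t + h) - f t\<bar> \<le> B * \<bar>h\<bar>"
    "\<And>t h. \<bar>f (t + h) - f t - deriv f t * h\<bar> \<le> B * h\<^sup>2"
proof -
  have "Ck (Suc (Suc 0)) f" using assms(1) by (simp only: numeral_2_eq_2)
  then obtain D1: "\<And>x. (f has_real_derivative deriv f x) (at x)" and C1: "Ck (Suc 0) (deriv f)"
    by (rule Ck_real_SucE) blast
  from C1 obtain D2: "\<And>x. (deriv f has_real_derivative deriv (deriv f) x) (at x)"
    and C2: "Ck 0 (deriv (deriv f))"
    by (rule Ck_real_SucE) blast
  have S1: "compactly_supported_in UNIV (deriv f)"
    using assms(2) D1 by (rule compactly_supported_in_deriv)
  have S2: "compactly_supported_in UNIV (deriv (deriv f))"
    using S1 D2 by (rule compactly_supported_in_deriv)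
  obtain B0 where B0: "\<And>x. \<bar>f x\<bar> \<le> B0"
    using bounded_continuous_compact_support[OF Ck_continuous[OF assms(1)] assms(2)] by blast
  obtain B1 where B1: "\<And>x. \<bar>deriv f x\<bar> \<le> B1"
    using bounded_continuous_compact_support[OF Ck_continuous[OF C1] S1] by blast
  obtain B2 where B2: "\<And>x. \<bar>deriv (deriv f) x\<bar> \<le> B2"
    using bounded_continuous_compact_support[OF Ck_continuous[OF C2] S2] by blast
  define B where "B = max B0 (max B1 B2)"
  have B: "\<bar>f x\<bar> \<le> B" "\<bar>deriv f x\<bar> \<le> B" "\<bar>deriv (deriv f) x\<bar> \<le> B" for x
    using B0[of x] B1[of x] B2[of x] by (auto simp: B_def)
  have lip: "\<bar>f (t + h) - f t\<bar> \<le> B * \<bar>h\<bar>" for t h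
    using field_differentiable_bound[of UNIV f "deriv f" B "t + h" t] D1 B by simp
  have lip': "\<bar>deriv f s - deriv f t\<bar> \<le> B * \<bar>s - t\<bar>" for s t
    using field_differentiable_bound[of UNIV "deriv f" "deriv (deriv f)" B s t] D2 B by simp
  have "\<bar>f (t + h) - f t - deriv f t * h\<bar> \<le> B * h\<^sup>2" for t h
  proof -
    have "norm ((f (t + h) - deriv f t * (t + h)) - (f t - deriv f t * t)) \<le> B * \<bar>h\<bar> * norm (t + h - t)"
    proof (rule field_differentiable_bound[of "closed_segment t (t + h)"])
      show "((\<lambda>s. f s - deriv f t * s) has_real_derivative deriv f s - deriv f t)
          (at s within closed_segment t (t + h))" for s
        by (rule DERIV_subset[where s = UNIV]) (auto intro!: derivative_eq_intros D1)
      show "norm (deriv f s - deriv f t) \<le> B * \<bar>h\<bar>" if "s \<in> closed_segment t (t + h)" for s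
      proof -
        have "\<bar>s - t\<bar> \<le> \<bar>h\<bar>" using that by (auto simp: closed_segment_eq_real_ivl split: if_splits)
        then have "B * \<bar>s - t\<bar> \<le> B * \<bar>h\<bar>" using B(1)[of 0] by (intro mult_left_mono) auto
        with lip'[of s t] show ?thesis by simp
      qed
    qed auto
    moreover have "B * \<bar>h\<bar> * norm (t + h - t) = B * h\<^sup>2" by (simp add: power2_eq_square)
    moreover have "(f (t + h) - deriv f t * (t + h)) - (f t - deriv f t * t)
        = f (t + h) - f t - deriv f t * h"
      by (simp add: algebra_simps)
    ultimately show ?thesis by (simp only: real_norm_def)
  qed
  with lip B(1,2) Ck_continuous[OF C1] show ?thesis by (intro that)
qed

section \<open>Weak gradients\<close>

text \<open>Weak identities are integrals over U, while integrability is known on compact sets and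
  the argument proceeds box by box; this passes between these domains.\<close>

lemma lebesgue_on_restrict_support:
  fixes f :: "'a::euclidean_space \<Rightarrow> 'b::{banach, second_countable_topology}"
  assumes "S \<subseteq> T" "S \<in> sets lebesgue" "T \<in> sets lebesgue" "\<And>x. x \<in> T \<Longrightarrow> x \<notin> S \<Longrightarrow> f x = 0"
  shows "integrable (lebesgue_on T) f \<longleftrightarrow> integrable (lebesgue_on S) f"
    "integral\<^sup>L (lebesgue_on T) f = integral\<^sup>L (lebesgue_on S) f"
proof -
  have "(\<lambda>x. indicator T x *\<^sub>R f x) = (\<lambda>x. indicator S x *\<^sub>R f x)"
    using assms by (auto simp: indicator_def fun_eq_iff)
  then show "integrable (lebesgue_on T) f \<longleftrightarrow> integrable (lebesgue_on S) f"
    "integral\<^sup>L (lebesgue_on T) f = integral\<^sup>L (lebesgue_on S) f"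
    using assms by (simp_all add: integrable_restrict_space integral_restrict_space)
qed

section \<open>A smooth step, cutoffs of boxes and the fundamental lemma\<close>

locale unit_mass_bump =
  fixes \<psi> :: "real \<Rightarrow> real"
  assumes test: "test_function {0<..<1} \<psi>"
    and nonneg: "\<And>s. \<psi> s \<ge> 0"
    and mass: "integral {0..1} \<psi> = 1"
begin

text \<open>The given bump supplies the nontrivial test functions, so none has to be built from
  exponentials. Starting the integral at -1, left of the support, makes 0 an interior point; further
  left the interval is empty and the value is 0, as it should be.\<close>

definition step :: "real \<Rightarrow> real" where
  "step t = integral {-1..t} \<psi>"

lemma Ck_bump: "Ck n \<psi>"
  using test by (simp add: test_function_def smooth_def)

lemma bump_eq_0: "s \<le> 0 \<or> 1 \<le> s \<Longrightarrow> \<psi> s = 0"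
proof -
  assume "s \<le> 0 \<or> 1 \<le> s"
  then have "s \<notin> {0<..<1}" by auto
  moreover obtain K where "K \<subseteq> {0<..<1}" "\<And>x. x \<notin> K \<Longrightarrow> \<psi> x = 0"
    using test[unfolded test_function_def, THEN conjunct2] by (rule compactly_supported_inE) blast
  ultimately show ?thesis by blast
qed

lemma bump_integrable: "\<psi> integrable_on {a..b}"
  by (rule integrable_continuous_interval) (meson Ck_bump Ck_continuous continuous_on_subset subset_UNIV)

lemma step_eq_0: "t \<le> 0 \<Longrightarrow> step t = 0"
proof -
  assume "t \<le> 0"
  then have "integral {-1..t} \<psi> = integral {-1..t} (\<lambda>s. 0)"
    by (intro integral_cong bump_eq_0) auto
  then show ?thesis by (simp add: step_def)
qed

lemma step_eq_1: "1 \<le> t \<Longrightarrow> step t = 1"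
proof -
  assume t: "1 \<le> t"
  have "integral {1..t} \<psi> = integral {1..t} (\<lambda>s. 0)"
    by (intro integral_cong bump_eq_0) auto
  moreover have "step t = integral {-1..0} \<psi> + (integral {0..1} \<psi> + integral {1..t} \<psi>)"
    unfolding step_def
    using Henstock_Kurzweil_Integration.integral_combine[of "-1" 0 t \<psi>]
      Henstock_Kurzweil_Integration.integral_combine[of 0 1 t \<psi>] t bump_integrable by simp
  ultimately show ?thesis using step_eq_0[of 0] mass by (simp add: step_def)
qed

lemma step_bounds: "0 \<le> step t" "step t \<le> 1"
proof -
  show "0 \<le> step t" unfolding step_def by (intro integral_nonneg bump_integrable nonneg)
  have "step t \<le> step (max t 1)" unfolding step_def
    by (intro integral_subset_le bump_integrable) (auto simp: nonneg)
  then show "step t \<le> 1" by (simp add: step_eq_1)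
qed

lemma has_derivative_step: "(step has_real_derivative \<psi> t) (at t)"
proof (cases "t < 0")
  case True
  have "((\<lambda>_. 0) has_real_derivative 0) (at t)" by simp
  then have "(step has_real_derivative 0) (at t)"
    by (rule has_field_derivative_transform_within_open[of _ _ _ "{..<0}"])
      (use True in \<open>auto simp: step_eq_0\<close>)
  with True show ?thesis by (simp add: bump_eq_0)
next
  case False
  have "(step has_real_derivative \<psi> t) (at t within {-1..t+1})"
    unfolding step_def[abs_def] using False Ck_bump
    by (intro integral_has_real_derivative) (auto intro: continuous_on_subset[OF Ck_continuous])
  moreover have "at t within {-1..t+1} = at t"
    using False by (intro at_within_interior) auto
  ultimately show ?thesis by simp
qed

lemma Ck_step: "Ck n step"
  by (rule Ck_SucD, rule Ck_real_SucI[OF has_derivative_step Ck_bump])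

text \<open>In each coordinate, one step rises from the lower face and one falls to the upper face,
  steepening with n. Since the step vanishes up to 0 and is 1 from 1 on, the product is zero off the
  open box and eventually exactly 1 at each of its points.\<close>

lemma exists_test_functions_approximating_box:
  fixes a b :: "'a::euclidean_space"
  assumes "cbox a b \<subseteq> U"
  obtains \<eta> :: "nat \<Rightarrow> 'a \<Rightarrow> real" where
    "\<And>n. test_function U (\<eta> n)" "\<And>n x. \<bar>\<eta> n x\<bar> \<le> 1" "\<And>n x. x \<notin> cbox a b \<Longrightarrow> \<eta> n x = 0"
    "\<And>x. (\<lambda>n. \<eta> n x) \<longlonglongrightarrow> indicator (box a b) x"
proof -
  define \<eta> :: "nat \<Rightarrow> 'a \<Rightarrow> real" where
    "\<eta> n x = (\<Prod>i\<in>Basis. step (real n * (x \<bullet> i) + (- real n * (a \<bullet> i)))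
      * step ((- real n) * (x \<bullet> i) + real n * (b \<bullet> i)))" for n x
  \<comment> \<open>The definition has the affine shape required by the smoothness lemma; this
    recovers the geometric form.\<close>
  have fac: "step (real n * (x \<bullet> i) + (- real n * (a \<bullet> i))) = step (real n * (x \<bullet> i - a \<bullet> i))"
    "step ((- real n) * (x \<bullet> i) + real n * (b \<bullet> i)) = step (real n * (b \<bullet> i - x \<bullet> i))" for n x i
    by (simp_all add: algebra_simps)
  have zero: "\<eta> n x = 0" if "x \<notin> box a b" for n x
  proof -
    from that obtain i where i: "i \<in> Basis" "x \<bullet> i \<le> a \<bullet> i \<or> b \<bullet> i \<le> x \<bullet> i"
      by (auto simp: mem_box not_less)
    then have "step (real n * (x \<bullet> i - a \<bullet> i)) * step (real n * (b \<bullet> i - x \<bullet> i)) = 0"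
      using step_eq_0 by (auto simp: mult_nonneg_nonpos)
    with i show ?thesis unfolding \<eta>_def fac by (intro prod_zero) auto
  qed
  have zero': "\<eta> n x = 0" if "x \<notin> cbox a b" for n x
    using zero box_subset_cbox that by blast
  have "Ck m (\<eta> n)" for m n
    unfolding \<eta>_def[abs_def] by (intro Ck_prod Ck_mult Ck_compose_affine_inner Ck_step)
  then have "test_function U (\<eta> n)" for n
    unfolding test_function_def smooth_def
    using compactly_supported_inI[OF compact_cbox assms, of "\<eta> n"] zero' by blast
  moreover have "\<bar>\<eta> n x\<bar> \<le> 1" for n x
    unfolding \<eta>_def abs_prod by (intro prod_le_1) (auto simp: abs_mult step_bounds intro!: mult_le_one)
  moreover have "(\<lambda>n. \<eta> n x) \<longlonglongrightarrow> indicator (box a b) x" for x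
  proof (cases "x \<in> box a b")
    case True
    have lim: "(\<lambda>n. step (real n * d)) \<longlonglongrightarrow> 1" if "d > 0" for d
    proof (rule tendsto_eventually)
      have "\<forall>\<^sub>F n in sequentially. 1 / d \<le> real n"
        using filterlim_real_sequentially by (auto simp: filterlim_at_top)
      then show "\<forall>\<^sub>F n in sequentially. step (real n * d) = 1"
        by eventually_elim (use that in \<open>auto simp: field_simps intro!: step_eq_1\<close>)
    qed
    have "(\<lambda>n. \<Prod>i\<in>Basis. step (real n * (x \<bullet> i - a \<bullet> i)) * step (real n * (b \<bullet> i - x \<bullet> i)))
        \<longlonglongrightarrow> (\<Prod>i\<in>(Basis::'a set). 1 * 1)"
      using True by (intro tendsto_prod tendsto_mult lim) (auto simp: mem_box)
    with True show ?thesis unfolding \<eta>_def fac by simp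
  qed (simp add: zero)
  ultimately show ?thesis using zero' by (intro that)
qed

text \<open>Cutoffs of boxes and dominated convergence show that \<open>g\<close> has integral zero
  over every box in U; Lebesgue differentiation over shrinking cubes then recovers \<open>g\<close>
  almost everywhere.\<close>

lemma fundamental_lemma_calculus_of_variations:
  fixes g :: "'a::euclidean_space \<Rightarrow> real"
  assumes U: "open U" and g: "locally_integrable_on U g"
    and orth: "\<And>\<eta>. test_function U \<eta> \<Longrightarrow> (LINT x|lebesgue_on U. g x * \<eta> x) = 0"
  shows "AE x in lebesgue_on U. g x = 0"
proof -
  have int: "integrable (lebesgue_on (cbox a b)) g" if "cbox a b \<subseteq> U" for a b
    using g that unfolding locally_integrable_on_def by auto
  have box0: "integral (cbox a b) g = 0" if sub: "cbox a b \<subseteq> U" for a b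
  proof -
    obtain \<eta> :: "nat \<Rightarrow> 'a \<Rightarrow> real" where \<eta>: "\<And>n. test_function U (\<eta> n)" "\<And>n x. \<bar>\<eta> n x\<bar> \<le> 1"
      "\<And>n x. x \<notin> cbox a b \<Longrightarrow> \<eta> n x = 0" "\<And>x. (\<lambda>n. \<eta> n x) \<longlonglongrightarrow> indicator (box a b) x"
      by (rule exists_test_functions_approximating_box[OF sub]) blast
    let ?M = "lebesgue_on (cbox a b)"
    have [measurable]: "g \<in> borel_measurable ?M" using int[OF sub] by auto
    have [measurable]: "\<eta> n \<in> borel_measurable ?M" for n
    proof -
      have "continuous_on UNIV (\<eta> n)"
        using \<eta>(1)[of n] by (auto simp: test_function_def smooth_def intro: Ck_continuous[of 0])
      then show ?thesis
        by (intro continuous_imp_measurable_on_sets_lebesgue) (auto intro: continuous_on_subset)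
    qed
    have [measurable]: "(indicator (box a b) :: 'a \<Rightarrow> real) \<in> borel_measurable ?M"
      by (intro measurable_restrict_space1 borel_measurable_indicator) auto
    have "(\<lambda>n. LINT x|?M. g x * \<eta> n x) \<longlonglongrightarrow> (LINT x|?M. g x * indicator (box a b) x)"
    proof (rule integral_dominated_convergence[where w = "\<lambda>x. \<bar>g x\<bar>"])
      show "integrable ?M (\<lambda>x. \<bar>g x\<bar>)" using int[OF sub] by simp
      show "AE x in ?M. (\<lambda>n. g x * \<eta> n x) \<longlonglongrightarrow> g x * indicator (box a b) x"
        by (intro AE_I2 tendsto_mult tendsto_const \<eta>)
      show "AE x in ?M. norm (g x * \<eta> n x) \<le> \<bar>g x\<bar>" for n
        using \<eta>(2) by (intro AE_I2) (simp add: abs_mult mult_left_le)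
    qed measurable
    moreover have "(LINT x|?M. g x * \<eta> n x) = 0" for n
    proof -
      have "(LINT x|lebesgue_on U. g x * \<eta> n x) = (LINT x|?M. g x * \<eta> n x)"
        using sub U \<eta>(3) by (intro lebesgue_on_restrict_support) (auto simp: borel_open)
      with orth[OF \<eta>(1)] show ?thesis by simp
    qed
    ultimately have "(LINT x|?M. g x * indicator (box a b) x) = 0"
      by (simp add: LIMSEQ_const_iff)
    also have "(LINT x|?M. g x * indicator (box a b) x)
        = (LINT x|lebesgue_on (box a b). g x * indicator (box a b) x)"
      using box_subset_cbox by (intro lebesgue_on_restrict_support) auto
    also have "\<dots> = (LINT x|lebesgue_on (box a b). g x)"
      by (intro Bochner_Integration.integral_cong) auto
    also have "\<dots> = integral (box a b) g"
    proof (rule lebesgue_integral_eq_integral)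
      have "integrable ?M (\<lambda>x. g x * indicator (box a b) x)"
      proof (rule Bochner_Integration.integrable_bound[OF int[OF sub]])
        show "(\<lambda>x. g x * indicator (box a b) x) \<in> borel_measurable ?M" by measurable
      qed (auto split: split_indicator)
      then have "integrable (lebesgue_on (box a b)) (\<lambda>x. g x * indicator (box a b) x)"
        using lebesgue_on_restrict_support(1)[of "box a b" "cbox a b" "\<lambda>x. g x * indicator (box a b) x"]
          box_subset_cbox by auto
      then show "integrable (lebesgue_on (box a b)) g"
        by (rule Bochner_Integration.integrable_cong[THEN iffD1, rotated -1]) auto
    qed auto
    finally show ?thesis by (simp add: integral_open_interval)
  qed
  have "negligible {x \<in> U. g x \<noteq> 0}"
  proof (subst locally_negligible_alt, rule ballI)
    fix x0 assume x0: "x0 \<in> {x \<in> U. g x \<noteq> 0}"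
    then obtain c d where cd: "cbox c d \<subseteq> U" "x0 \<in> box c d"
      using U by (auto elim: open_contains_cbox)
    \<comment> \<open>The differentiation theorem asks for integrability on all boxes of the space,
      which \<open>g\<close> has only inside U. Hence the cutoff to a small box, and negligibility
      is proved locally.\<close>
    define f where "f x = (if x \<in> cbox c d then g x else 0)" for x
    have "g integrable_on cbox c d" by (rule integrable_on_lebesgue_on[OF int[OF cd(1)]]) simp
    then have "f integrable_on UNIV"
      unfolding f_def by (simp only: Henstock_Kurzweil_Integration.integrable_restrict_UNIV)
    then have "f integrable_on cbox a b" for a b by (rule integrable_on_subcbox) simp
    then obtain N where N: "negligible N"
      "\<And>x e. x \<notin> N \<Longrightarrow> 0 < e \<Longrightarrow> \<exists>d>0. \<forall>h. 0 < h \<and> h < d \<longrightarrow>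
         norm (integral (cbox x (x + h *\<^sub>R One)) f /\<^sub>R h ^ DIM('a) - f x) < e"
      by (rule integrable_ccontinuous_explicit) blast
    have "g x = 0" if x: "x \<in> box c d" "x \<notin> N" for x
    proof (rule ccontr)
      assume "g x \<noteq> 0"
      \<comment> \<open>With error bound |g x|, a vanishing average over a small cube at x would
        force |g x| < |g x|.\<close>
      then obtain d1 where d1: "d1 > 0" "\<And>h. 0 < h \<Longrightarrow> h < d1 \<Longrightarrow>
          norm (integral (cbox x (x + h *\<^sub>R One)) f /\<^sub>R h ^ DIM('a) - f x) < \<bar>g x\<bar>"
        using N(2)[OF x(2), of "\<bar>g x\<bar>"] by auto
      have "((\<lambda>h. x + h *\<^sub>R One) \<longlongrightarrow> x + 0 *\<^sub>R One) (at_right 0)"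
        by (intro tendsto_intros)
      then have "\<forall>\<^sub>F h in at_right 0. x + h *\<^sub>R One \<in> box c d"
        using x(1) by (intro topological_tendstoD[where S = "box c d"]) auto
      moreover have "\<forall>\<^sub>F h in at_right 0. h \<in> {0<..<d1}"
        using d1(1) by (rule eventually_at_right_real)
      ultimately have "\<forall>\<^sub>F h in at_right 0. x + h *\<^sub>R One \<in> box c d \<and> h \<in> {0<..<d1}"
        by (rule eventually_conj)
      then obtain h where h: "x + h *\<^sub>R One \<in> box c d" "0 < h" "h < d1"
        using eventually_happens[of _ "at_right (0::real)"] by auto
      have sub: "cbox x (x + h *\<^sub>R One) \<subseteq> cbox c d"
        using x(1) h(1) by (intro subset_box_imp) (auto simp: mem_box intro: less_imp_le)
      have "integral (cbox x (x + h *\<^sub>R One)) f = integral (cbox x (x + h *\<^sub>R One)) g"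
        using sub by (intro Henstock_Kurzweil_Integration.integral_cong) (auto simp: f_def)
      also have "\<dots> = 0" using sub cd(1) by (intro box0) auto
      finally have "\<bar>f x\<bar> < \<bar>g x\<bar>" using d1(2)[OF h(2,3)] by simp
      moreover have "x \<in> cbox c d" using x(1) box_subset_cbox by blast
      ultimately show False by (simp add: f_def)
    qed
    then have "negligible ({x \<in> U. g x \<noteq> 0} \<inter> box c d)"
      by (intro negligible_subset[OF N(1)]) auto
    then show "\<exists>V. openin (top_of_set {x \<in> U. g x \<noteq> 0}) V \<and> x0 \<in> V \<and> negligible V"
      using x0 cd(2) by (intro exI[of _ "{x \<in> U. g x \<noteq> 0} \<inter> box c d"]) (auto intro: openin_open_Int)
  qed
  then have "{x \<in> U. g x \<noteq> 0} \<in> null_sets lebesgue" by (simp add: negligible_iff_null_sets)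
  then have "AE x in lebesgue. x \<in> U \<longrightarrow> g x = 0" by (rule AE_I') auto
  then show ?thesis using U by (subst AE_restrict_space_iff) (auto simp: borel_open)
qed

end

section \<open>Pairing with test functions; uniqueness and classical gradients\<close>

lemma locally_integrable_on_add:
  "locally_integrable_on U f \<Longrightarrow> locally_integrable_on U g \<Longrightarrow> locally_integrable_on U (\<lambda>x. f x + g x)"
  by (auto simp: locally_integrable_on_def)

lemma locally_integrable_on_inner:
  "locally_integrable_on U f \<Longrightarrow> locally_integrable_on U (\<lambda>x. f x \<bullet> i)"
  by (auto simp: locally_integrable_on_def)

lemma locally_integrable_on_continuous:
  "continuous_on U f \<Longrightarrow> locally_integrable_on U f"
  unfolding locally_integrable_on_def
proof safe
  fix K assume "continuous_on U f" "compact K" "K \<subseteq> U"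
  then have "integrable lborel (\<lambda>x. indicator K x *\<^sub>R f x)"
    by (intro borel_integrable_compact) (auto intro: continuous_on_subset)
  then have "integrable lebesgue (\<lambda>x. indicator K x *\<^sub>R f x)"
    by (subst integrable_completion) auto
  then show "integrable (lebesgue_on K) f"
    using \<open>compact K\<close> by (subst integrable_restrict_space) (auto simp: borel_compact)
qed

lemma integrable_mult_compactly_supported:
  fixes g e :: "'a::euclidean_space \<Rightarrow> real"
  assumes "U \<in> sets lebesgue" "locally_integrable_on U g" "continuous_on UNIV e"
    "compactly_supported_in U e"
  shows "integrable (lebesgue_on U) (\<lambda>x. g x * e x)"
proof -
  obtain K where K: "compact K" "K \<subseteq> U" "\<And>x. x \<notin> K \<Longrightarrow> e x = 0"
    using assms(4) by (rule compactly_supported_inE) blast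
  have Km: "K \<in> sets lebesgue" using K(1) by (simp add: borel_compact)
  obtain B where B: "\<And>x. \<bar>e x\<bar> \<le> B"
    using bounded_continuous_compact_support[OF assms(3,4)] by blast
  have g: "integrable (lebesgue_on K) g" using assms(2) K by (simp add: locally_integrable_on_def)
  have "integrable (lebesgue_on K) (\<lambda>x. g x * e x)"
  proof (rule Bochner_Integration.integrable_bound)
    show "integrable (lebesgue_on K) (\<lambda>x. B * g x)" using g by simp
    have "e \<in> borel_measurable (lebesgue_on K)"
      using assms(3) Km by (intro continuous_imp_measurable_on_sets_lebesgue) (auto intro: continuous_on_subset)
    then show "(\<lambda>x. g x * e x) \<in> borel_measurable (lebesgue_on K)" using g by measurable
    have "\<bar>g x\<bar> * \<bar>e x\<bar> \<le> \<bar>g x\<bar> * \<bar>B\<bar>" for x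
      using B[of x] by (intro mult_left_mono) auto
    then show "AE x in lebesgue_on K. norm (g x * e x) \<le> norm (B * g x)"
      by (intro AE_I2) (simp add: abs_mult mult.commute)
  qed
  then show ?thesis
    using lebesgue_on_restrict_support(1)[OF K(2) Km assms(1), of "\<lambda>x. g x * e x"] K(3) by simp
qed

lemma test_functionD:
  assumes "test_function U \<eta>"
  shows "(\<eta> has_derivative frechet_derivative \<eta> (at x)) (at x)"
    "continuous_on UNIV \<eta>" "compactly_supported_in U \<eta>"
    "i \<in> Basis \<Longrightarrow> continuous_on UNIV (\<lambda>x. frechet_derivative \<eta> (at x) i)"
    "compactly_supported_in U (\<lambda>x. frechet_derivative \<eta> (at x) i)"
proof -
  have C: "Ck (Suc 0) \<eta>" and S: "compactly_supported_in U \<eta>"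
    using assms by (auto simp: test_function_def smooth_def)
  have D: "(\<eta> has_derivative frechet_derivative \<eta> (at x)) (at x)" for x
    using C by (simp add: frechet_derivative_works)
  then show "(\<eta> has_derivative frechet_derivative \<eta> (at x)) (at x)" .
  show "continuous_on UNIV \<eta>" by (rule Ck_continuous[OF C])
  show "compactly_supported_in U \<eta>" by (rule S)
  show "continuous_on UNIV (\<lambda>x. frechet_derivative \<eta> (at x) i)" if "i \<in> Basis"
    using C that by simp
  obtain K where K: "compact K" "K \<subseteq> U" "\<And>x. x \<notin> K \<Longrightarrow> \<eta> x = 0"
    using S by (rule compactly_supported_inE) blast
  show "compactly_supported_in U (\<lambda>x. frechet_derivative \<eta> (at x) i)"
    using has_derivative_zero_off_support[OF D compact_imp_closed[OF K(1)] K(3)]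
    by (intro compactly_supported_inI[OF K(1,2)]) simp
qed

lemma weak_gradient_mult_integrable:
  assumes "open U" "is_weak_gradient U f g" "test_function U \<eta>" "i \<in> Basis"
  shows "integrable (lebesgue_on U) (\<lambda>x. f x * frechet_derivative \<eta> (at x) i)"
    "integrable (lebesgue_on U) (\<lambda>x. (g x \<bullet> i) * \<eta> x)"
  using assms test_functionD[OF assms(3)] unfolding is_weak_gradient_def
  by (auto intro!: integrable_mult_compactly_supported locally_integrable_on_inner simp: borel_open)

lemma is_weak_gradient_add:
  assumes "open U" "is_weak_gradient U f g" "is_weak_gradient U f' g'"
  shows "is_weak_gradient U (\<lambda>x. f x + f' x) (\<lambda>x. g x + g' x)"
  using assms weak_gradient_mult_integrable[OF assms(1,2)] weak_gradient_mult_integrable[OF assms(1,3)]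
  unfolding is_weak_gradient_def
  by (auto simp: locally_integrable_on_add distrib_right inner_add_left)

text \<open>Each coordinate of the difference is orthogonal to all test functions.\<close>

lemma (in unit_mass_bump) weak_gradient_unique:
  fixes g h :: "'a::euclidean_space \<Rightarrow> 'a"
  assumes U: "open U" and g: "is_weak_gradient U f g" and h: "is_weak_gradient U f h"
  shows "AE x in lebesgue_on U. g x = h x"
proof -
  have "AE x in lebesgue_on U. g x \<bullet> i - h x \<bullet> i = 0" if i: "i \<in> Basis" for i :: 'a
  proof (rule fundamental_lemma_calculus_of_variations[OF U])
    show "locally_integrable_on U (\<lambda>x. g x \<bullet> i - h x \<bullet> i)"
      using g h by (auto simp: is_weak_gradient_def locally_integrable_on_def)
    show "(LINT x|lebesgue_on U. (g x \<bullet> i - h x \<bullet> i) * \<eta> x) = 0" if \<eta>: "test_function U \<eta>" for \<eta>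
    proof -
      have "(LINT x|lebesgue_on U. (g x \<bullet> i) * \<eta> x) = (LINT x|lebesgue_on U. (h x \<bullet> i) * \<eta> x)"
        using g h \<eta> i by (simp add: is_weak_gradient_def)
      then show ?thesis
        using weak_gradient_mult_integrable(2)[OF U g \<eta> i] weak_gradient_mult_integrable(2)[OF U h \<eta> i]
        by (simp add: left_diff_distrib)
    qed
  qed
  then have "AE x in lebesgue_on U. \<forall>i\<in>Basis. g x \<bullet> i - h x \<bullet> i = 0"
    by (intro AE_finite_allI) auto
  then show ?thesis by eventually_elim (simp add: euclidean_eq_iff[of "g _"])
qed

text \<open>Differentiates the translation-invariant integral \<open>\<integral> h (x + t i) dx\<close> at \<open>t = 0\<close>.\<close>

lemma integral_partial_derivative_eq_0:
  fixes h :: "'a::euclidean_space \<Rightarrow> real"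
  assumes D: "\<And>x. (h has_derivative F x) (at x)" and cont: "continuous_on UNIV (\<lambda>x. F x i)"
    and supp: "compactly_supported_in UNIV h"
  shows "(LINT x|lborel. F x i) = 0"
proof -
  obtain K where K: "compact K" "\<And>x. x \<notin> K \<Longrightarrow> h x = 0"
    using supp by (rule compactly_supported_inE) blast
  have "compactly_supported_in UNIV (\<lambda>x. F x i)"
    using has_derivative_zero_off_support[OF D compact_imp_closed[OF K(1)] K(2)] K(1)
    by (intro compactly_supported_inI[of K]) auto
  from bounded_continuous_compact_support[OF cont this] obtain B where B: "\<And>x. \<bar>F x i\<bar> \<le> B" by blast
  have B0: "0 \<le> B" using B[of 0] by simp
  obtain R where R: "\<And>x. x \<in> K \<Longrightarrow> norm x \<le> R"
    using K(1) compact_imp_bounded bounded_iff by metis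
  have contH: "continuous_on UNIV h"
    using D by (auto simp: continuous_on_eq_continuous_at intro: has_derivative_continuous)
  then have [measurable]: "h \<in> borel_measurable borel" by (rule borel_measurable_continuous_onI)
  have hint: "integrable lborel h"
  proof -
    have "(\<lambda>x. indicator K x *\<^sub>R h x) = h" using K(2) by (auto simp: indicator_def fun_eq_iff)
    moreover have "integrable lborel (\<lambda>x. indicator K x *\<^sub>R h x)"
      using K(1) contH by (intro borel_integrable_compact) (auto intro: continuous_on_subset)
    ultimately show ?thesis by simp
  qed
  have line: "((\<lambda>s. h (x + s *\<^sub>R i)) has_real_derivative F (x + s *\<^sub>R i) i) (at s)" for x s
  proof -
    have "((\<lambda>s. h (x + s *\<^sub>R i)) has_derivative (\<lambda>y. F (x + s *\<^sub>R i) (y *\<^sub>R i))) (at s)"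
      by (rule has_derivative_compose[OF _ D]) (auto intro!: derivative_eq_intros)
    moreover have "(\<lambda>y. F (x + s *\<^sub>R i) (y *\<^sub>R i)) = (*) (F (x + s *\<^sub>R i) i)"
      using linear_cmul[OF has_derivative_linear[OF D]] by (simp add: fun_eq_iff mult.commute)
    ultimately show ?thesis by (simp add: has_field_derivative_def)
  qed
  \<comment> \<open>A sequence of difference quotients suits dominated convergence;
    \<open>Suc\<close> keeps the increments positive.\<close>
  define t where "t n = inverse (real (Suc n))" for n
  have t: "0 < t n" "t n \<le> 1" for n by (auto simp: t_def field_simps)
  define q where "q n x = (h (x + t n *\<^sub>R i) - h x) / t n" for n x
  have [measurable]: "q n \<in> borel_measurable borel" for n unfolding q_def by measurable
  have shift: "integrable lborel (\<lambda>x. h (x + c))" "(LINT x|lborel. h (x + c)) = integral\<^sup>L lborel h" for c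
    using integrable_distr[of "(+) c" lborel borel h] integral_distr[of "(+) c" lborel borel h] hint
    by (simp_all add: lborel_distr_plus add.commute)
  have q0: "(LINT x|lborel. q n x) = 0" for n
    unfolding q_def using shift[of "t n *\<^sub>R i"] hint by simp
  have "(\<lambda>n. LINT x|lborel. q n x) \<longlonglongrightarrow> (LINT x|lborel. F x i)"
  \<comment> \<open>The quotients are at most \<open>B\<close> by the mean value inequality, and
    shifts no longer than \<open>norm i\<close> cannot reach \<open>K\<close> from outside this
    ball.\<close>
  proof (rule integral_dominated_convergence[where w = "\<lambda>x. indicator (cball 0 (R + norm i)) x *\<^sub>R B"])
    show "(\<lambda>x. F x i) \<in> borel_measurable lborel"
      using borel_measurable_continuous_onI[OF cont] by simp
    show "integrable lborel (\<lambda>x. indicator (cball 0 (R + norm i)) x *\<^sub>R B)"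
      by (intro borel_integrable_compact) auto
    have "(\<lambda>n. q n x) \<longlonglongrightarrow> F x i" for x
    proof -
      have "((\<lambda>k. (h (x + (0 + k) *\<^sub>R i) - h (x + 0 *\<^sub>R i)) / k) \<longlongrightarrow> F (x + 0 *\<^sub>R i) i) (at 0)"
        using line[of x 0] unfolding DERIV_def .
      moreover have "filterlim t (at 0) sequentially"
        using t LIMSEQ_inverse_real_of_nat unfolding filterlim_at t_def[symmetric]
        by (simp add: t_def[symmetric] order_less_imp_not_eq2)
      ultimately show ?thesis unfolding q_def by (auto dest: filterlim_compose)
    qed
    then show "AE x in lborel. (\<lambda>n. q n x) \<longlonglongrightarrow> F x i" by simp
    have "\<bar>q n x\<bar> \<le> indicator (cball 0 (R + norm i)) x *\<^sub>R B" for n x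
    proof (cases "x \<in> cball 0 (R + norm i)")
      case True
      have "\<bar>h (x + t n *\<^sub>R i) - h (x + 0 *\<^sub>R i)\<bar> \<le> B * \<bar>t n - 0\<bar>"
        using field_differentiable_bound[of UNIV "\<lambda>s. h (x + s *\<^sub>R i)" "\<lambda>s. F (x + s *\<^sub>R i) i" B "t n" 0]
          line B by simp
      then have "\<bar>q n x\<bar> \<le> B" using t[of n] by (simp add: q_def field_simps)
      with True show ?thesis by simp
    next
      case False
      have "norm x \<le> norm (x + t n *\<^sub>R i) + norm i"
      proof -
        have "norm x \<le> norm (x + t n *\<^sub>R i) + norm (t n *\<^sub>R i)"
          using norm_triangle_ineq4[of "x + t n *\<^sub>R i" "t n *\<^sub>R i"] by simp
        also have "norm (t n *\<^sub>R i) \<le> norm i" using t[of n] by (simp add: mult_left_le_one_le)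
        finally show ?thesis by simp
      qed
      moreover have "R + norm i < norm x" using False by simp
      ultimately have "x \<notin> K" "x + t n *\<^sub>R i \<notin> K"
        using R[of x] R[of "x + t n *\<^sub>R i"] norm_ge_zero[of i] by (auto simp del: norm_ge_zero)
      with K(2) B0 show ?thesis by (simp add: q_def)
    qed
    then show "AE x in lborel. norm (q n x) \<le> indicator (cball 0 (R + norm i)) x *\<^sub>R B" for n
      by simp
  qed simp
  then show ?thesis unfolding q0 by (simp add: LIMSEQ_const_iff)
qed

text \<open>Integration by parts: f times a test function, extended by zero, is continuously
  differentiable on the whole space, and its partial derivatives integrate to zero.\<close>

lemma is_weak_gradient_classical:
  fixes f :: "'a::euclidean_space \<Rightarrow> real"
  assumes U: "open U" and D: "\<And>x. x \<in> U \<Longrightarrow> (f has_derivative (\<lambda>v. g x \<bullet> v)) (at x)"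
    and cont: "continuous_on U g"
  shows "is_weak_gradient U f g"
  unfolding is_weak_gradient_def
proof (intro conjI allI impI ballI)
  have cf: "continuous_on U f"
    using D by (meson continuous_at_imp_continuous_on has_derivative_continuous)
  show lf: "locally_integrable_on U f" by (rule locally_integrable_on_continuous[OF cf])
  show lg: "locally_integrable_on U g" by (rule locally_integrable_on_continuous[OF cont])
  fix \<eta> and i :: 'a assume \<eta>: "test_function U \<eta>" and i: "i \<in> Basis"
  note T = test_functionD[OF \<eta>]
  let ?D = "\<lambda>x. frechet_derivative \<eta> (at x)"
  obtain K where K: "compact K" "K \<subseteq> U" "\<And>x. x \<notin> K \<Longrightarrow> \<eta> x = 0"
    using T(3) by (rule compactly_supported_inE) blast
  have D0: "?D x = (\<lambda>v. 0)" if "x \<notin> K" for x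
    using has_derivative_zero_off_support[OF T(1) compact_imp_closed[OF K(1)] K(3) that] .
  define h where "h x = (if x \<in> U then f x * \<eta> x else 0)" for x
  define F where "F x v = (if x \<in> U then f x * ?D x v + (g x \<bullet> v) * \<eta> x else 0)" for x v
  have "(h has_derivative F x) (at x)" for x
  proof (cases "x \<in> U")
    case True
    have "((\<lambda>y. f y * \<eta> y) has_derivative F x) (at x)"
      using has_derivative_mult[OF D[OF True] T(1)] True by (simp add: F_def[abs_def])
    then show ?thesis
      by (rule has_derivative_transform_within_open[OF _ U True]) (simp add: h_def)
  next
    case False
    \<comment> \<open>A point outside U has the open set - K as a neighbourhood on which
      \<open>h\<close> vanishes.\<close>
    have "((\<lambda>y. 0) has_derivative (\<lambda>v. 0)) (at x)" by simp
    then have "(h has_derivative (\<lambda>v. 0)) (at x)"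
      by (rule has_derivative_transform_within_open[of _ _ _ _ "- K"])
        (use K False in \<open>auto simp: h_def compact_imp_closed\<close>)
    with False show ?thesis by (simp add: F_def[abs_def])
  qed
  moreover have "continuous_on UNIV (\<lambda>x. F x i)"
  proof -
    have "continuous_on U (\<lambda>x. f x * ?D x i + (g x \<bullet> i) * \<eta> x)"
      using T(2) T(4)[OF i] by (intro continuous_intros cf cont) (auto intro: continuous_on_subset)
    then have "continuous_on U (\<lambda>x. F x i)" by (rule continuous_on_eq) (simp add: F_def)
    moreover have "continuous_on (- K) (\<lambda>x. F x i)"
      using continuous_on_const[of "- K" "0::real"]
      by (rule continuous_on_eq) (auto simp: F_def D0 K(3))
    ultimately have "continuous_on (U \<union> - K) (\<lambda>x. F x i)"
      using U K(1) by (intro continuous_on_open_Un) (auto simp: compact_imp_closed)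
    moreover have "U \<union> - K = UNIV" using K(2) by auto
    ultimately show ?thesis by simp
  qed
  moreover have "compactly_supported_in UNIV h"
    by (rule compactly_supported_inI[OF K(1)]) (auto simp: h_def K(3))
  ultimately have "(LINT x|lborel. F x i) = 0"
    by (rule integral_partial_derivative_eq_0)
  moreover have "(LINT x|lborel. F x i) = (LINT x|lebesgue_on U. f x * ?D x i + (g x \<bullet> i) * \<eta> x)"
  proof -
    have "(LINT x|lborel. F x i) = (LINT x|lebesgue. F x i)"
      using \<open>continuous_on UNIV (\<lambda>x. F x i)\<close>
      by (intro integral_completion[symmetric]) (simp add: borel_measurable_continuous_onI)
    also have "\<dots> = (LINT x|lebesgue. indicator U x *\<^sub>R (f x * ?D x i + (g x \<bullet> i) * \<eta> x))"
      by (intro Bochner_Integration.integral_cong) (auto simp: F_def)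
    also have "\<dots> = (LINT x|lebesgue_on U. f x * ?D x i + (g x \<bullet> i) * \<eta> x)"
      using U by (subst integral_restrict_space) (auto simp: borel_open)
    finally show ?thesis .
  qed
  moreover have "integrable (lebesgue_on U) (\<lambda>x. f x * ?D x i)"
    using U lf T i by (intro integrable_mult_compactly_supported) (auto simp: borel_open)
  moreover have "integrable (lebesgue_on U) (\<lambda>x. (g x \<bullet> i) * \<eta> x)"
    using U lg T by (intro integrable_mult_compactly_supported locally_integrable_on_inner) (auto simp: borel_open)
  ultimately show "(LINT x|lebesgue_on U. f x * ?D x i) = - (LINT x|lebesgue_on U. (g x \<bullet> i) * \<eta> x)"
    by simp
qed

section \<open>Integration of the expansion\<close>

text \<open>A substitute for Hoelder's inequality: integrate \<open>z ^ s \<le> 1 + z powr p\<close>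
  at z = |f x| / N. Rescaling by N gives the right homogeneity \<open>N ^ s\<close>, and the summand
  1 contributes the total measure.\<close>

lemma integral_power_le_norm_powr:
  fixes f :: "'a \<Rightarrow> real"
  assumes fin: "finite_measure M" and [measurable]: "f \<in> borel_measurable M"
    and int: "integrable M (\<lambda>x. \<bar>f x\<bar> powr p)" and le: "(LINT x|M. \<bar>f x\<bar> powr p) \<le> N powr p"
    and N: "0 \<le> N" and s: "0 < s" "real s \<le> p"
  shows "integrable M (\<lambda>x. \<bar>f x\<bar> ^ s)"
    "(LINT x|M. \<bar>f x\<bar> ^ s) \<le> N ^ s * (measure M (space M) + 1)"
proof -
  interpret finite_measure M by (rule fin)
  have key: "z ^ s \<le> 1 + z powr p" if "0 \<le> z" for z :: real
  proof (cases "z \<le> 1")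
    case True
    then have "z ^ s \<le> 1" using that by (simp add: power_le_one)
    then show ?thesis by (simp add: add_increasing2)
  next
    case False
    then have "z ^ s = z powr real s" by (simp add: powr_realpow)
    also have "\<dots> \<le> z powr p" using False s by (intro powr_mono) auto
    finally show ?thesis by simp
  qed
  show i: "integrable M (\<lambda>x. \<bar>f x\<bar> ^ s)"
  proof (rule Bochner_Integration.integrable_bound)
    show "integrable M (\<lambda>x. 1 + \<bar>f x\<bar> powr p)" using int by simp
    have "norm (\<bar>f x\<bar> ^ s) \<le> norm (1 + \<bar>f x\<bar> powr p)" for x
      using key[of "\<bar>f x\<bar>"] by simp
    then show "AE x in M. norm (\<bar>f x\<bar> ^ s) \<le> norm (1 + \<bar>f x\<bar> powr p)" by simp
  qed measurable
  show "(LINT x|M. \<bar>f x\<bar> ^ s) \<le> N ^ s * (measure M (space M) + 1)"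
  \<comment> \<open>Rescaling divides by N; if N = 0, then \<open>f\<close> vanishes almost
    everywhere.\<close>
  proof (cases "N = 0")
    case True
    have "(LINT x|M. \<bar>f x\<bar> powr p) = 0"
      using le True by (intro antisym) (auto intro: integral_nonneg_AE)
    then have "AE x in M. \<bar>f x\<bar> powr p = 0"
      using int by (subst (asm) integral_nonneg_eq_0_iff_AE) auto
    then have "AE x in M. \<bar>f x\<bar> ^ s = 0" by eventually_elim (use s in auto)
    then have "(LINT x|M. \<bar>f x\<bar> ^ s) = 0" by (rule integral_eq_zero_AE)
    then show ?thesis using True s by simp
  next
    case False
    with N have N0: "N > 0" by simp
    have pt: "\<bar>f x\<bar> ^ s \<le> N ^ s * (1 + \<bar>f x\<bar> powr p / N powr p)" for x
    proof -
      have "\<bar>f x\<bar> ^ s = N ^ s * (\<bar>f x\<bar> / N) ^ s" using N0 by (simp add: power_divide)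
      also have "\<dots> \<le> N ^ s * (1 + (\<bar>f x\<bar> / N) powr p)"
        using N0 by (intro mult_left_mono key) auto
      finally show ?thesis using N0 by (simp add: powr_divide)
    qed
    have "(LINT x|M. \<bar>f x\<bar> ^ s) \<le> (LINT x|M. N ^ s * (1 + \<bar>f x\<bar> powr p / N powr p))"
      using i int pt by (intro integral_mono) auto
    also have "\<dots> = N ^ s * (measure M (space M) + (LINT x|M. \<bar>f x\<bar> powr p) / N powr p)"
      using int by (simp add: Bochner_Integration.integral_add)
    also have "\<dots> \<le> N ^ s * (measure M (space M) + 1)"
      using N0 le by (intro mult_left_mono add_left_mono) (auto simp: divide_le_eq)
    finally show ?thesis .
  qed
qed

text \<open>Completeness of Lebesgue measure; it carries measurability over to whichever
  representative \<open>weak_grad\<close> has chosen.\<close>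

lemma borel_measurable_lebesgue_on_AE:
  fixes f g :: "'a::euclidean_space \<Rightarrow> 'b::euclidean_space"
  assumes "S \<in> sets lebesgue" "f \<in> borel_measurable (lebesgue_on S)" "AE x in lebesgue_on S. f x = g x"
  shows "g \<in> borel_measurable (lebesgue_on S)"
proof -
  have "(\<lambda>x. indicator S x *\<^sub>R f x) \<in> borel_measurable lebesgue"
    using assms by (simp add: borel_measurable_restrict_space_iff)
  moreover have "AE x in lebesgue. indicator S x *\<^sub>R f x = indicator S x *\<^sub>R g x"
    using assms(3) unfolding AE_restrict_space_iff[of S lebesgue, simplified, OF assms(1)]
    by eventually_elim (auto simp: indicator_def)
  ultimately have "(\<lambda>x. indicator S x *\<^sub>R g x) \<in> borel_measurable lebesgue"
    by (rule borel_measurable_AE)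
  then show ?thesis using assms(1) by (simp add: borel_measurable_restrict_space_iff)
qed

section \<open>Measurability of the integrand and evaluation of the functional\<close>

lemma borel_measurable_entry:
  fixes k :: "'a \<Rightarrow> real^'n^'m"
  assumes "k \<in> borel_measurable M"
  shows "(\<lambda>x. k x $ i $ j) \<in> borel_measurable M"
  by (rule measurable_compose[OF assms]) (intro borel_measurable_continuous_onI continuous_intros)

lemma borel_measurable_coordinate:
  fixes w :: "'a \<Rightarrow> real^'n"
  assumes "w \<in> borel_measurable M"
  shows "(\<lambda>x. w x $ i) \<in> borel_measurable M"
  by (rule measurable_compose[OF assms]) (intro borel_measurable_continuous_onI continuous_intros)

lemma borel_measurable_det_3:
  fixes k :: "'a \<Rightarrow> real^3^3"
  assumes "\<And>i j. (\<lambda>x. k x $ i $ j) \<in> borel_measurable M"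
  shows "(\<lambda>x. det (k x)) \<in> borel_measurable M"
  unfolding det_3 using assms by measurable

text \<open>Cramer's rule writes the inverse matrix through quotients of determinants, hence as a
  measurable expression in the entries.\<close>

lemma borel_measurable_inverse_quadratic_form:
  fixes k :: "'a \<Rightarrow> real^3^3"
  assumes k: "\<And>i j. (\<lambda>x. k x $ i $ j) \<in> borel_measurable M"
    and w: "w \<in> borel_measurable M" and inv: "\<And>x. x \<in> space M \<Longrightarrow> invertible (k x)"
  shows "(\<lambda>x. w x \<bullet> (matrix_inv (k x) *v w x)) \<in> borel_measurable M"
proof -
  have w': "(\<lambda>x. w x $ i) \<in> borel_measurable M" for i by (rule borel_measurable_coordinate[OF w])
  define d where "d m x = det (\<chi> i j. if j = m then w x $ i else k x $ i $ j)" for m x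
  have d: "d m \<in> borel_measurable M" for m
    unfolding d_def by (rule borel_measurable_det_3) (use k w' in auto)
  have D: "(\<lambda>x. det (k x)) \<in> borel_measurable M" by (rule borel_measurable_det_3[OF k])
  have "w x \<bullet> (matrix_inv (k x) *v w x) = (\<Sum>m\<in>UNIV. w x $ m * (d m x / det (k x)))"
    if "x \<in> space M" for x
  proof -
    have "det (k x) \<noteq> 0" using inv[OF that] by (simp add: invertible_det_nz)
    then have "matrix_inv (k x) *v w x = (\<chi> m. d m x / det (k x))"
      using matrix_inv_vector_mult[OF inv[OF that], of "w x"] unfolding d_def by (subst (asm) cramer)
    then show ?thesis by (simp add: inner_vec_def)
  qed
  moreover have "(\<lambda>x. \<Sum>m\<in>UNIV. w x $ m * (d m x / det (k x))) \<in> borel_measurable M"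
    using w' d D by measurable
  ultimately show ?thesis by (subst measurable_cong) auto
qed

text \<open>Raising the index inserts two inverses and the length one metric factor; a single
  inverse survives, which is the form expanded above.\<close>

lemma metric_norm_metric_grad:
  assumes "invertible (\<gamma> y)"
  shows "metric_norm \<gamma> y (metric_grad \<gamma> U f y)
    = sqrt (weak_grad U f y \<bullet> (matrix_inv (\<gamma> y) *v weak_grad U f y))"
  by (simp add: metric_norm_def metric_grad_def matrix_inv_vector_mult[OF assms] inner_commute)

lemma D_functional_flat:
  "D_functional \<psi> U flat_metric f
    = c_psi \<psi> + (LINT y|lebesgue_on U. phi \<psi> (f y) * norm (weak_grad U f y) ^ 3)"
proof -
  have inv: "invertible (mat 1 :: real^3^3)" by (simp add: invertible_det_nz)
  have "matrix_inv (mat 1) *v w = w" for w :: "real^3"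
    using matrix_inv_vector_mult[OF inv, of w] by simp
  then have "metric_norm flat_metric y (metric_grad flat_metric U f y) = norm (weak_grad U f y)" for y
    using metric_norm_metric_grad[of flat_metric y U f] inv
    by (simp add: flat_metric_def norm_eq_sqrt_inner)
  then show ?thesis by (simp add: D_functional_def volume_density_def flat_metric_def)
qed

lemma weak_gradient_weak_grad: "is_weak_gradient U f g \<Longrightarrow> is_weak_gradient U f (weak_grad U f)"
  unfolding weak_grad_def by (rule someI[of "is_weak_gradient U f"])

text \<open>Membership provides some p-integrable weak gradient, not necessarily the chosen one;
  uniqueness transfers the integrability.\<close>

lemma (in unit_mass_bump) in_W1p_weak_grad:
  assumes U: "open U" and "in_W1p U p v"
  shows "is_weak_gradient U v (weak_grad U v)" "in_Lp U p (weak_grad U v)"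
proof -
  obtain g where g: "is_weak_gradient U v g" "in_Lp U p g" using assms by (auto simp: in_W1p_def)
  show w: "is_weak_gradient U v (weak_grad U v)" by (rule weak_gradient_weak_grad[OF g(1)])
  have ae: "AE x in lebesgue_on U. g x = weak_grad U v x" by (rule weak_gradient_unique[OF U g(1) w])
  have gm [measurable]: "g \<in> borel_measurable (lebesgue_on U)" using g(2) by (simp add: in_Lp_def)
  have [measurable]: "weak_grad U v \<in> borel_measurable (lebesgue_on U)"
    by (rule borel_measurable_lebesgue_on_AE[OF _ gm ae]) (use U in \<open>simp add: borel_open\<close>)
  have "integrable (lebesgue_on U) (\<lambda>x. norm (g x) powr p)" using g(2) by (simp add: in_Lp_def)
  then have "integrable (lebesgue_on U) (\<lambda>x. norm (weak_grad U v x) powr p)"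
    by (rule Bochner_Integration.integrable_cong_AE_imp) (use ae in \<open>auto elim: eventually_mono\<close>)
  then show "in_Lp U p (weak_grad U v)" by (simp add: in_Lp_def)
qed

lemma Lp_le_W1p_norm:
  assumes "p > 0"
  shows "0 \<le> W1p_norm U p v"
    "(LINT x|lebesgue_on U. \<bar>v x\<bar> powr p) \<le> W1p_norm U p v powr p"
    "(LINT x|lebesgue_on U. norm (weak_grad U v x) powr p) \<le> W1p_norm U p v powr p"
proof -
  have "0 \<le> (LINT x|lebesgue_on U. \<bar>v x\<bar> powr p)"
    "0 \<le> (LINT x|lebesgue_on U. norm (weak_grad U v x) powr p)"
    by (auto intro: integral_nonneg_AE)
  moreover from this have "W1p_norm U p v powr p
      = (LINT x|lebesgue_on U. \<bar>v x\<bar> powr p) + (LINT x|lebesgue_on U. norm (weak_grad U v x) powr p)"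
    using assms by (simp add: W1p_norm_def powr_powr)
  ultimately show "(LINT x|lebesgue_on U. \<bar>v x\<bar> powr p) \<le> W1p_norm U p v powr p"
    "(LINT x|lebesgue_on U. norm (weak_grad U v x) powr p) \<le> W1p_norm U p v powr p"
    by auto
  show "0 \<le> W1p_norm U p v" by (simp add: W1p_norm_def)
qed

section \<open>The annulus and the classical gradient of \<open>rho\<close>\<close>

lemma open_annulus: "open (annulus l L)"
  unfolding annulus_def by (intro open_Diff) auto

lemma norm_in_annulus: "y \<in> annulus l L \<Longrightarrow> l < norm y"
  by (simp add: annulus_def)

lemma annulus_nonempty:
  assumes "0 < l" "l < L" shows "annulus l L \<noteq> {}"
proof -
  obtain y :: "real^3" where "norm y = (l + L) / 2"
    using vector_choose_size[of "(l + L) / 2"] assms by auto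
  with assms have "y \<in> annulus l L" by (simp add: annulus_def)
  then show ?thesis by blast
qed

lemma finite_measure_annulus: "finite_measure (lebesgue_on (annulus l L))"
proof -
  have "annulus l L \<in> lmeasurable"
    by (rule lmeasurable_open[OF _ open_annulus]) (auto simp: annulus_def intro: bounded_subset[OF bounded_ball])
  then show ?thesis by (rule finite_measure_lebesgue_on)
qed

lemma is_weak_gradient_rho:
  assumes "0 < l"
  shows "is_weak_gradient (annulus l L) rho (\<lambda>y. - (1 / norm y ^ 3) *\<^sub>R y)"
proof (rule is_weak_gradient_classical[OF open_annulus])
  have nz: "y \<noteq> 0" if "y \<in> annulus l L" for y
    using norm_in_annulus[OF that] assms by auto
  show "continuous_on (annulus l L) (\<lambda>y. - (1 / norm y ^ 3) *\<^sub>R y)"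
    using nz by (auto intro!: continuous_intros)
  show "(rho has_derivative (\<lambda>v. (- (1 / norm y ^ 3) *\<^sub>R y) \<bullet> v)) (at y)" if "y \<in> annulus l L" for y
  proof -
    have y: "norm y \<noteq> 0" using nz[OF that] by simp
    have "((\<lambda>y. inverse (norm y)) has_derivative
        (\<lambda>v. - (inverse (norm y) * (v \<bullet> sgn y) * inverse (norm y)))) (at y)"
      using y by (intro Deriv.has_derivative_inverse has_derivative_norm) auto
    moreover have "- (inverse (norm y) * (v \<bullet> sgn y) * inverse (norm y)) = (- (1 / norm y ^ 3) *\<^sub>R y) \<bullet> v" for v
      using y by (simp add: sgn_div_norm power3_eq_cube inner_commute field_simps)
    ultimately show ?thesis by (simp add: rho_def[abs_def])
  qed
qed

lemma norm_grad_rho_le: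
  assumes "0 < l" "y \<in> annulus l L"
  shows "norm (- (1 / norm y ^ 3) *\<^sub>R y) \<le> 1 / l\<^sup>2"
proof -
  have y: "l < norm y" using norm_in_annulus[OF assms(2)] .
  have "norm (- (1 / norm y ^ 3) *\<^sub>R y) = 1 / (norm y)\<^sup>2"
    using y assms by (simp add: power2_eq_square power3_eq_cube)
  also have "\<dots> \<le> 1 / l\<^sup>2"
    using y assms by (intro divide_left_mono power_mono mult_pos_pos zero_less_power) auto
  finally show ?thesis .
qed

lemma norm_le_C0_norm:
  assumes "bounded_continuous_symmetric U k" "y \<in> U"
  shows "norm (k y) \<le> C0_norm U k"
  unfolding C0_norm_def using assms
  by (intro cSUP_upper) (auto simp: bounded_continuous_symmetric_def bounded_iff bdd_above_def)

theorem proposition6p1: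
  fixes \<psi> :: "real \<Rightarrow> real" and l L p :: real
  assumes "test_function {0<..<1} \<psi>"
    and "\<And>s. \<psi> s \<ge> 0"
    and "integral {0..1} \<psi> = 1"
    and "0 < l" and "l < L"
    and "compactly_supported_in (annulus l L) (\<lambda>y. phi \<psi> (rho y))"
    and "3 < p"
  shows "\<exists>\<delta>\<^sub>0>0. \<exists>C. \<exists>R :: tensor2 \<Rightarrow> (real^3 \<Rightarrow> real) \<Rightarrow> real. \<forall>k v.
    bounded_continuous_symmetric (annulus l L) k \<longrightarrow>
    in_W1p (annulus l L) p v \<longrightarrow>
    C0_norm (annulus l L) k + W1p_norm (annulus l L) p v \<le> \<delta>\<^sub>0 \<longrightarrow>
      D_functional \<psi> (annulus l L) (\<lambda>y. flat_metric y + k y) (\<lambda>y. rho y + v y)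
        = D_functional \<psi> (annulus l L) flat_metric rho + L_D \<psi> (annulus l L) k v + R k v
      \<and> \<bar>R k v\<bar> \<le> C * (C0_norm (annulus l L) k + W1p_norm (annulus l L) p v)\<^sup>2"
proof -
  interpret unit_mass_bump \<psi> using assms(1-3) by unfold_locales
  define U where "U = annulus l L"
  define M where "M = lebesgue_on U"
  define \<phi> where "\<phi> = phi \<psi>"
  define w where "w = weak_grad U rho"
  define \<alpha> where "\<alpha> = 1 / l\<^sup>2"
  have U: "open U" by (simp add: U_def open_annulus)
  have US: "U \<in> sets lebesgue" using U by (simp add: borel_open)
  have spM: "space M = U" by (simp add: M_def space_restrict_space)
  interpret M: finite_measure M unfolding M_def U_def by (rule finite_measure_annulus)
  define \<mu> where "\<mu> = measure M (space M)"
  have \<mu>: "0 \<le> \<mu>" by (simp add: \<mu>_def)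
  obtain B where cont': "continuous_on UNIV (deriv \<phi>)" and B: "\<And>t. \<bar>\<phi> t\<bar> \<le> B" "\<And>t. \<bar>deriv \<phi> t\<bar> \<le> B"
      "\<And>t h. \<bar>\<phi> (t + h) - \<phi> t\<bar> \<le> B * \<bar>h\<bar>" "\<And>t h. \<bar>\<phi> (t + h) - \<phi> t - deriv \<phi> t * h\<bar> \<le> B * h\<^sup>2"
    unfolding \<phi>_def
    by (rule C2_compact_support_Taylor[OF Ck_phi[OF test] compactly_supported_in_phi[OF test]]) blast
  have B0: "0 \<le> B" using B(1)[of 0] by simp
  have [measurable]: "\<phi> \<in> borel_measurable borel" "deriv \<phi> \<in> borel_measurable borel"
    using cont' Ck_continuous[OF Ck_phi[OF test, of 0]]
    by (simp_all add: \<phi>_def borel_measurable_continuous_onI)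
  have wg_rho: "is_weak_gradient U rho (\<lambda>y. - (1 / norm y ^ 3) *\<^sub>R y)"
    unfolding U_def by (rule is_weak_gradient_rho[OF assms(4)])
  have wg_w: "is_weak_gradient U rho w" unfolding w_def by (rule weak_gradient_weak_grad[OF wg_rho])
  have w_eq: "AE y in M. - (1 / norm y ^ 3) *\<^sub>R y = w y"
    unfolding M_def by (rule weak_gradient_unique[OF U wg_rho wg_w])
  have nz: "y \<noteq> 0" if "y \<in> U" for y
    using norm_in_annulus[of y l L] that assms(4) by (auto simp: U_def)
  have w_le: "AE y in M. norm (w y) \<le> \<alpha>"
    using w_eq AE_space[of M]
  proof eventually_elim
    case (elim y)
    then show ?case using norm_grad_rho_le[OF assms(4), of y L] by (simp add: spM U_def \<alpha>_def)
  qed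
  have \<alpha>: "0 \<le> \<alpha>" by (simp add: \<alpha>_def)
  have [measurable]: "w \<in> borel_measurable M"
    unfolding M_def
  proof (rule borel_measurable_lebesgue_on_AE[OF US _ w_eq[unfolded M_def]])
    show "(\<lambda>y. - (1 / norm y ^ 3) *\<^sub>R y) \<in> borel_measurable (lebesgue_on U)"
      using nz US by (intro continuous_imp_measurable_on_sets_lebesgue) (auto intro!: continuous_intros)
  qed
  have [measurable]: "rho \<in> borel_measurable M"
    unfolding M_def rho_def[abs_def] using nz US
    by (intro continuous_imp_measurable_on_sets_lebesgue) (auto intro!: continuous_intros)
  \<comment> \<open>The first factors come from the pointwise bound; the 4 counts its terms
    \<open>\<kappa>\<^sup>2\<close>, \<open>v\<^sup>2\<close>, |b|^2 and |b|^3, each of which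
    integrates to at most \<mu> + 1 times the squared sum of the norms.\<close>
  define C where "C = 20000 * B * (1 + \<alpha>) ^ 3 * (4 * (\<mu> + 1))"
  \<comment> \<open>The remainder is the actual difference, so the identity holds by definition and
    only the quadratic bound has content.\<close>
  define R where "R k v = D_functional \<psi> U (\<lambda>y. flat_metric y + k y) (\<lambda>y. rho y + v y)
    - D_functional \<psi> U flat_metric rho - L_D \<psi> U k v" for k v
  \<comment> \<open>The threshold 1/24 is the one of the matrix expansion; it also gives N \<le> 1,
    so that the cubic term is bounded by a quadratic one.\<close>
  have "\<bar>R k v\<bar> \<le> C * (C0_norm U k + W1p_norm U p v)\<^sup>2"
    if k: "bounded_continuous_symmetric U k" and v: "in_W1p U p v"
      and small: "C0_norm U k + W1p_norm U p v \<le> 1/24" for k v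
  proof -
    define \<kappa> where "\<kappa> = C0_norm U k"
    define N where "N = W1p_norm U p v"
    define b where "b = weak_grad U v"
    define z where "z = weak_grad U (\<lambda>y. rho y + v y)"
    have kb: "norm (k y) \<le> \<kappa>" if "y \<in> U" for y
      unfolding \<kappa>_def by (rule norm_le_C0_norm[OF k that])
    have N0: "0 \<le> N" unfolding N_def using assms(7) by (intro Lp_le_W1p_norm) auto
    \<comment> \<open>A supremum bounds the norms from above only where there are points, so a point
      of the annulus has to be exhibited.\<close>
    have \<kappa>0: "0 \<le> \<kappa>"
    proof -
      obtain y where "y \<in> U" using annulus_nonempty[OF assms(4,5)] by (auto simp: U_def)
      from order_trans[OF norm_ge_zero kb[OF this]] show ?thesis .
    qed
    have \<kappa>1: "\<kappa> \<le> 1/24" and N1: "N \<le> 1" using small \<kappa>0 N0 by (auto simp: \<kappa>_def N_def)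
    have wg_b: "is_weak_gradient U v b" and Lp_b: "in_Lp U p b"
      unfolding b_def using in_W1p_weak_grad[OF U v] by auto
    have Lp_v: "in_Lp U p v" using v by (simp add: in_W1p_def)
    have bm [measurable]: "b \<in> borel_measurable M" and vm [measurable]: "v \<in> borel_measurable M"
      using Lp_b Lp_v by (auto simp: in_Lp_def M_def)
    have wg_z: "is_weak_gradient U (\<lambda>y. rho y + v y) (\<lambda>y. w y + b y)"
      by (rule is_weak_gradient_add[OF U wg_w wg_b])
    have z_eq: "AE y in M. w y + b y = z y"
      unfolding M_def z_def by (rule weak_gradient_unique[OF U wg_z weak_gradient_weak_grad[OF wg_z]])
    have zm [measurable]: "z \<in> borel_measurable M"
      unfolding M_def by (rule borel_measurable_lebesgue_on_AE[OF US _ z_eq[unfolded M_def]]) (simp flip: M_def)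
    have km [measurable]: "k \<in> borel_measurable M"
      unfolding M_def using k US
      by (intro continuous_imp_measurable_on_sets_lebesgue) (auto simp: bounded_continuous_symmetric_def)
    note entry [measurable] = borel_measurable_entry[OF km]
    have inv: "invertible (mat 1 + k y)" if "y \<in> U" for y
      using kb[OF that] \<kappa>1 by (intro invertible_mat_1_plus) simp
    have gm: "(\<lambda>y. (mat 1 + k y) $ i $ j) \<in> borel_measurable M" for i j
      unfolding vector_add_component by measurable
    have qm [measurable]: "(\<lambda>y. z y \<bullet> (matrix_inv (mat 1 + k y) *v z y)) \<in> borel_measurable M"
      using inv by (intro borel_measurable_inverse_quadratic_form gm zm) (simp add: spM)
    have dm [measurable]: "(\<lambda>y. det (mat 1 + k y)) \<in> borel_measurable M"
      by (rule borel_measurable_det_3[OF gm])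
    have tm [measurable]: "(\<lambda>y. trace (k y)) \<in> borel_measurable M"
      unfolding trace_def by measurable
    have kwm [measurable]: "(\<lambda>y. w y \<bullet> (k y *v w y)) \<in> borel_measurable M"
    proof -
      have [measurable]: "(\<lambda>y. w y $ i) \<in> borel_measurable M" for i
        by (rule borel_measurable_coordinate) measurable
      show ?thesis unfolding inner_vec_def matrix_vector_mult_def by simp
    qed

    have pv: "integrable M (\<lambda>y. \<bar>v y\<bar> powr p)" "(LINT y|M. \<bar>v y\<bar> powr p) \<le> N powr p"
      using Lp_v Lp_le_W1p_norm[where p = p and v = v and U = U] assms(7) by (auto simp: in_Lp_def M_def N_def)
    have pb: "integrable M (\<lambda>y. \<bar>norm (b y)\<bar> powr p)" "(LINT y|M. \<bar>norm (b y)\<bar> powr p) \<le> N powr p"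
      using Lp_b Lp_le_W1p_norm[where p = p and v = v and U = U] assms(7) by (auto simp: in_Lp_def M_def N_def b_def)
    \<comment> \<open>First powers serve the integrability of the linear terms; second and third
      powers control the remainder.\<close>
    note power_v = integral_power_le_norm_powr[OF M.finite_measure_axioms vm pv N0]
    have nbm: "(\<lambda>y. norm (b y)) \<in> borel_measurable M" by measurable
    note power_b = integral_power_le_norm_powr[OF M.finite_measure_axioms nbm pb N0]
    have v1: "integrable M (\<lambda>y. \<bar>v y\<bar>)" using power_v(1)[of 1] assms(7) by simp
    have b1: "integrable M (\<lambda>y. norm (b y))" using power_b(1)[of 1] assms(7) by simp
    have v2: "integrable M (\<lambda>y. (v y)\<^sup>2)" "(LINT y|M. (v y)\<^sup>2) \<le> N\<^sup>2 * (\<mu> + 1)"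
      using power_v[of 2] assms(7) by (auto simp: \<mu>_def)
    have b2: "integrable M (\<lambda>y. (norm (b y))\<^sup>2)" "(LINT y|M. (norm (b y))\<^sup>2) \<le> N\<^sup>2 * (\<mu> + 1)"
      using power_b[of 2] assms(7) by (auto simp: \<mu>_def)
    have b3: "integrable M (\<lambda>y. norm (b y) ^ 3)" "(LINT y|M. norm (b y) ^ 3) \<le> N ^ 3 * (\<mu> + 1)"
      using power_b[of 3] assms(7) by (auto simp: \<mu>_def)

    define J where "J y = \<phi> (rho y + v y) * sqrt (z y \<bullet> (matrix_inv (mat 1 + k y) *v z y)) ^ 3
      * sqrt (det (mat 1 + k y))" for y
    define J0 where "J0 y = \<phi> (rho y) * norm (w y) ^ 3" for y
    define J1 where "J1 y = deriv \<phi> (rho y) * norm (w y) ^ 3 * v y" for y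
    define J2 where "J2 y = \<phi> (rho y) * norm (w y) * (w y \<bullet> b y)" for y
    define J3 where "J3 y = \<phi> (rho y) * (1/2 * trace (k y) * norm (w y) ^ 3
      - 3/2 * norm (w y) * (w y \<bullet> (k y *v w y)))" for y
    have Jm [measurable]: "J \<in> borel_measurable M" "J0 \<in> borel_measurable M" "J1 \<in> borel_measurable M"
        "J2 \<in> borel_measurable M" "J3 \<in> borel_measurable M"
      unfolding J_def J0_def J1_def J2_def J3_def by measurable
    define P where "P = 20000 * B * (1 + \<alpha>) ^ 3"
    have P: "0 \<le> P" using B0 \<alpha> by (simp add: P_def)
    define W where "W y = P * (\<kappa>\<^sup>2 + (v y)\<^sup>2 + (norm (b y))\<^sup>2 + norm (b y) ^ 3)" for y
    have W: "integrable M W" unfolding W_def using v2 b2 b3 by simp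
    have J0i: "integrable M J0"
    proof (rule Bochner_Integration.integrable_bound[of M "\<lambda>y. B * \<alpha> ^ 3"])
      show "AE y in M. norm (J0 y) \<le> norm (B * \<alpha> ^ 3)"
        using w_le by eventually_elim
          (use B0 B(1) \<alpha> in \<open>auto simp: J0_def abs_mult intro!: mult_mono power_mono\<close>)
    qed auto
    have J1i: "integrable M J1"
    proof (rule Bochner_Integration.integrable_bound[of M "\<lambda>y. B * \<alpha> ^ 3 * \<bar>v y\<bar>"])
      show "AE y in M. norm (J1 y) \<le> norm (B * \<alpha> ^ 3 * \<bar>v y\<bar>)"
        using w_le by eventually_elim
          (use B0 B(2) \<alpha> in \<open>auto simp: J1_def abs_mult intro!: mult_mono power_mono\<close>)
    qed (use v1 in auto)
    have J2i: "integrable M J2"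
    proof (rule Bochner_Integration.integrable_bound[of M "\<lambda>y. B * \<alpha> * (\<alpha> * norm (b y))"])
      show "AE y in M. norm (J2 y) \<le> norm (B * \<alpha> * (\<alpha> * norm (b y)))"
        using w_le
      proof eventually_elim
        case (elim y)
        have "\<bar>w y \<bullet> b y\<bar> \<le> \<alpha> * norm (b y)"
          using Cauchy_Schwarz_ineq2[of "w y" "b y"] mult_right_mono[OF elim, of "norm (b y)"] by simp
        then show ?case
          using B0 B(1) \<alpha> elim by (auto simp: J2_def abs_mult intro!: mult_mono)
      qed
    qed (use b1 in auto)
    have J3i: "integrable M J3"
    proof (rule Bochner_Integration.integrable_bound[of M "\<lambda>y. B * (9 * \<kappa> * \<alpha> ^ 3)"])
      show "AE y in M. norm (J3 y) \<le> norm (B * (9 * \<kappa> * \<alpha> ^ 3))"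
        using w_le AE_space[of M]
      proof eventually_elim
        case (elim y)
        have "9 * norm (k y) * norm (w y) ^ 3 \<le> 9 * \<kappa> * \<alpha> ^ 3"
          using elim kb[of y] \<kappa>0 by (intro mult_mono power_mono) (auto simp: spM)
        with cubic_form_bound[of "k y" "w y"] have "\<bar>1/2 * trace (k y) * norm (w y) ^ 3
            - 3/2 * norm (w y) * (w y \<bullet> (k y *v w y))\<bar> \<le> 9 * \<kappa> * \<alpha> ^ 3"
          by linarith
        then have "\<bar>J3 y\<bar> \<le> B * (9 * \<kappa> * \<alpha> ^ 3)"
          unfolding J3_def abs_mult[of "\<phi> _"] using B0 B(1) by (intro mult_mono) auto
        then show ?case by simp
      qed
    qed auto
    define E where "E y = J y - (J0 y + J1 y + 3 * J2 y + J3 y)" for y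
    have EW: "AE y in M. \<bar>E y\<bar> \<le> W y"
      using w_le z_eq AE_space[of M]
    proof eventually_elim
      case (elim y)
      then show ?case
        using remainder_pointwise_bound[of \<phi> "rho y" "v y" B "deriv \<phi>" "w y" \<alpha> "k y" \<kappa> "b y"] B kb[of y] \<kappa>1
        by (simp add: E_def J_def J0_def J1_def J2_def J3_def W_def P_def spM mult.assoc)
    qed
    \<comment> \<open>Integrability of \<open>J\<close> is never shown directly: \<open>E\<close> is
      dominated by \<open>W\<close>, and \<open>J\<close> is then a sum of integrable
      functions.\<close>
    have Ei: "integrable M E"
    proof (rule Bochner_Integration.integrable_bound[OF W])
      show "E \<in> borel_measurable M" unfolding E_def by measurable
      show "AE y in M. norm (E y) \<le> norm (W y)" using EW by eventually_elim simp
    qed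
    have "(LINT y|M. J y) = (LINT y|M. E y + (J0 y + J1 y + 3 * J2 y + J3 y))"
      by (simp add: E_def)
    also have "\<dots> = (LINT y|M. E y) + ((LINT y|M. J0 y) + (LINT y|M. J1 y) + 3 * (LINT y|M. J2 y) + (LINT y|M. J3 y))"
      using Ei J0i J1i J2i J3i by simp
    finally have split: "(LINT y|M. J y) = (LINT y|M. E y)
      + ((LINT y|M. J0 y) + (LINT y|M. J1 y) + 3 * (LINT y|M. J2 y) + (LINT y|M. J3 y))" .
    have "D_functional \<psi> U (\<lambda>y. flat_metric y + k y) (\<lambda>y. rho y + v y) = c_psi \<psi> + (LINT y|M. J y)"
      unfolding D_functional_def M_def[symmetric]
    proof (intro arg_cong2[where f = "(+)"] refl Bochner_Integration.integral_cong)
      fix y assume "y \<in> space M"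
      then have "invertible ((\<lambda>y. flat_metric y + k y) y)" using inv by (simp add: spM flat_metric_def)
      from metric_norm_metric_grad[where \<gamma> = "\<lambda>y. flat_metric y + k y", OF this, of U "\<lambda>y. rho y + v y"]
      show "phi \<psi> (rho y + v y) * metric_norm (\<lambda>y. flat_metric y + k y) y
          (metric_grad (\<lambda>y. flat_metric y + k y) U (\<lambda>y. rho y + v y) y) ^ 3
          * volume_density (\<lambda>y. flat_metric y + k y) y = J y"
        by (simp add: J_def \<phi>_def z_def volume_density_def flat_metric_def)
    qed
    moreover have "D_functional \<psi> U flat_metric rho = c_psi \<psi> + (LINT y|M. J0 y)"
      by (simp add: D_functional_flat M_def J0_def \<phi>_def w_def)
    moreover have "L_D \<psi> U k v = (LINT y|M. J1 y) + 3 * (LINT y|M. J2 y) + (LINT y|M. J3 y)"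
      by (simp add: L_D_def M_def J1_def J2_def J3_def \<phi>_def w_def b_def)
    ultimately have "R k v = (LINT y|M. E y)" by (simp add: R_def split)
    then have "\<bar>R k v\<bar> \<le> (LINT y|M. \<bar>E y\<bar>)" by simp
    also have "\<dots> \<le> (LINT y|M. W y)"
      using Ei W EW by (intro integral_mono_AE) auto
    also have "\<dots> = P * (\<kappa>\<^sup>2 * \<mu> + (LINT y|M. (v y)\<^sup>2) + (LINT y|M. (norm (b y))\<^sup>2) + (LINT y|M. norm (b y) ^ 3))"
      unfolding W_def using v2 b2 b3 by (simp add: \<mu>_def)
    also have "\<dots> \<le> P * ((\<kappa> + N)\<^sup>2 * (\<mu> + 1) + (\<kappa> + N)\<^sup>2 * (\<mu> + 1) + (\<kappa> + N)\<^sup>2 * (\<mu> + 1) + (\<kappa> + N)\<^sup>2 * (\<mu> + 1))"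
    proof (intro mult_left_mono add_mono P)
      have sq: "\<kappa>\<^sup>2 \<le> (\<kappa> + N)\<^sup>2" "N\<^sup>2 \<le> (\<kappa> + N)\<^sup>2" using \<kappa>0 N0 by (auto intro: power_mono)
      have "N ^ 3 \<le> N\<^sup>2" using N0 N1 by (intro power_decreasing) auto
      then have cu: "N ^ 3 \<le> (\<kappa> + N)\<^sup>2" using sq by simp
      show "\<kappa>\<^sup>2 * \<mu> \<le> (\<kappa> + N)\<^sup>2 * (\<mu> + 1)" using sq \<mu> by (intro mult_mono) auto
      show "(LINT y|M. (v y)\<^sup>2) \<le> (\<kappa> + N)\<^sup>2 * (\<mu> + 1)"
        using \<mu> by (intro order_trans[OF v2(2)] mult_right_mono sq(2)) simp
      show "(LINT y|M. (norm (b y))\<^sup>2) \<le> (\<kappa> + N)\<^sup>2 * (\<mu> + 1)"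
        using \<mu> by (intro order_trans[OF b2(2)] mult_right_mono sq(2)) simp
      show "(LINT y|M. norm (b y) ^ 3) \<le> (\<kappa> + N)\<^sup>2 * (\<mu> + 1)"
        using \<mu> by (intro order_trans[OF b3(2)] mult_right_mono cu) simp
    qed
    also have "\<dots> = C * (\<kappa> + N)\<^sup>2" by (simp add: C_def P_def)
    finally show ?thesis by (simp add: \<kappa>_def N_def)
  qed
  then show ?thesis
    by (intro exI[of _ "1/24"] conjI exI[of _ C] exI[of _ R]) (auto simp: R_def U_def)
qed

end
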